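(* For every positive integer $d$ there exists $v(d)>0$, and for every $\alpha\in(0,1)$ there exists $\beta=\beta(d,\alpha)>0$, such that the following holds. Let $\mathcal{F}$ be a family of $n$ convex sets in $\mathbb{R}^d$ such that at least $\alpha\binom{n}{d+1}$ of the $(d+1)$-element subfamilies $\{A_1,\dots,A_{d+1}\}\subseteq\mathcal{F}$ satisfy $\mathrm{vol}(A_1\cap\dots\cap A_{d+1})\ge1$. Then one can find at least $\beta n$ members of $\mathcal{F}$ whose common intersection has volume at least $v(d)$.
   Context: $\mathrm{vol}$ denotes $d$-dimensional Lebesgue measure.
   Formalization: The family is assumed to have n ≥ d+1 members; for 1 ≤ n ≤ d the binomial coefficient is 0, the hypothesis is vacuous, and the claim fails, e.g. for a family consisting of a single point. *)

theory Defs
  imports "HOL-Analysis.Analysis"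
begin

end

theory Submission
  imports Defs
begin

text \<open>
  By supersaturation, \<open>F\<close> contains many complete \<open>(d+1)\<close>-partite systems of \<open>(d+1)\<close>-tuples, with \<open>t\<close> sets in
  each class, all of whose transversals have large intersection. In such a system some class contains \<open>m\<close> sets
  whose intersection has volume at least some \<open>c > 0\<close> depending only on \<open>d\<close> and \<open>m\<close>. Otherwise the intersection of
  any \<open>m\<close> sets of a class lies in a polyhedron with \<open>2d\<close> facets and tiny volume, so that each transversal
  intersection contains a point outside all these polyhedra. By Ramsey one can select \<open>m\<close> sets of each class such
  that, in every class, all chosen points of some member lie beyond one and the same facet of the polyhedron of
  that class. Then the convex hulls of the points chosen in the members of a class have no common point, in any
  class, which contradicts the colourful Helly theorem.

  For \<open>m > 2d(d+1)\<close>, Helly's theorem shows that one of the \<open>m\<close> sets is redundant: the intersection \<open>P\<close> of the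
  others is larger in volume only by a bounded factor. By averaging, some fixed \<open>P\<close> serves a positive fraction of all
  sets of \<open>F\<close>. These meet \<open>P\<close> in a fixed proportion of its volume, so in suitable affine coordinates each of them
  contains one of boundedly many small balls, and the pigeonhole principle concludes the proof.
\<close>

section \<open>Complete multipartite systems\<close>

text \<open>Averaging: the rows with fewer than \<open>\<epsilon> / 2 * card Y\<close> related
  elements contribute at most half of the assumed total. The remaining rows supply the other half,
  and each of them contributes at most \<open>card Y\<close>.\<close>

lemma card_dense_fibres:
  fixes \<epsilon> :: real
  assumes fin: "finite X" "finite Y" and "Y \<noteq> {}" and "0 \<le> \<epsilon>"
    and dense: "\<epsilon> * card X * card Y \<le> card {p \<in> X \<times> Y. R (fst p) (snd p)}"
  shows "\<epsilon> / 2 * card X \<le> card {x \<in> X. \<epsilon> / 2 * card Y \<le> card {y \<in> Y. R x y}}"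
proof -
  let ?G = "{x \<in> X. \<epsilon> / 2 * card Y \<le> card {y \<in> Y. R x y}}"
  have "{p \<in> X \<times> Y. R (fst p) (snd p)} = (SIGMA x:X. {y \<in> Y. R x y})"
    by auto
  then have "\<epsilon> * card X * card Y \<le> (\<Sum>x\<in>X. real (card {y \<in> Y. R x y}))"
    using dense fin by (simp add: card_SigmaI)
  also have "\<dots> \<le> (\<Sum>x\<in>X. (if x \<in> ?G then real (card Y) else 0) + \<epsilon> / 2 * card Y)"
  proof (rule sum_mono)
    fix x assume x: "x \<in> X"
    have "card {y \<in> Y. R x y} \<le> card Y"
      using fin by (intro card_mono) auto
    then show "real (card {y \<in> Y. R x y}) \<le> (if x \<in> ?G then real (card Y) else 0) + \<epsilon> / 2 * card Y"
      using x \<open>0 \<le> \<epsilon>\<close> by (auto intro: add_increasing2)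
  qed
  also have "\<dots> = card ?G * real (card Y) + card X * (\<epsilon> / 2 * card Y)"
    using fin by (simp add: sum.distrib sum.If_cases Int_def)
  finally have "(\<epsilon> / 2 * card X) * card Y \<le> card ?G * card Y"
    by (simp add: algebra_simps)
  then show ?thesis
    using fin \<open>Y \<noteq> {}\<close> by (simp add: card_gt_0_iff)
qed

abbreviation words :: "'a set \<Rightarrow> nat \<Rightarrow> 'a list set" where
  "words V k \<equiv> {xs. set xs \<subseteq> V \<and> length xs = k}"

text \<open>A word of length \<open>r * t\<close> is read as \<open>r\<close> consecutive blocks of \<open>t\<close> letters; it is a grid if \<open>H\<close> holds for
  all \<open>r\<close>-letter words that take one letter from each block in turn.\<close>

primrec grid :: "nat \<Rightarrow> nat \<Rightarrow> ('a list \<Rightarrow> bool) \<Rightarrow> 'a list \<Rightarrow> bool" where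
  "grid t 0 H xs = H []"
| "grid t (Suc r) H xs = grid t r (\<lambda>y. \<forall>s<t. H (xs ! s # y)) (drop t xs)"

text \<open>Letter \<open>s\<close> of block \<open>i\<close> stands at position
  \<open>i * t + s\<close>, so the sequence \<open>\<sigma>\<close> selects one letter from each
  block.\<close>

lemma grid_D:
  "grid t r H xs \<Longrightarrow> length \<sigma> = r \<Longrightarrow> (\<And>i. i < r \<Longrightarrow> \<sigma> ! i < t) \<Longrightarrow> length xs = r * t \<Longrightarrow>
    H (map (\<lambda>i. xs ! (i * t + \<sigma> ! i)) [0..<r])"
proof (induction r arbitrary: H xs \<sigma>)
  case (Suc r)
  from Suc.prems obtain s \<sigma>' where \<sigma>: "\<sigma> = s # \<sigma>'" "length \<sigma>' = r"
    by (cases \<sigma>) auto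
  have s: "s < t" using Suc.prems(3)[of 0] \<sigma> by simp
  have "\<sigma>' ! i < t" if "i < r" for i
    using Suc.prems(3)[of "Suc i"] that \<sigma> by simp
  then have "\<forall>s<t. H (xs ! s # map (\<lambda>i. drop t xs ! (i * t + \<sigma>' ! i)) [0..<r])"
    using Suc.prems Suc.IH[of "\<lambda>y. \<forall>s<t. H (xs ! s # y)" "drop t xs" \<sigma>'] \<sigma> by simp
  \<comment> \<open>Dropping the first block lowers every later position by \<open>t\<close>, which
    matches the shift from \<open>Suc i\<close> to \<open>i\<close>.\<close>
  moreover have "map (\<lambda>i. xs ! (i * t + \<sigma> ! i)) [0..<Suc r]
      = xs ! s # map (\<lambda>i. drop t xs ! (i * t + \<sigma>' ! i)) [0..<r]"
    unfolding upt_conv_Cons[OF zero_less_Suc] map_Suc_upt[symmetric]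
    using Suc.prems(4) by (simp add: \<sigma> add.assoc)
  ultimately show ?case using s by simp
qed simp

text \<open>Induction on \<open>r\<close>, averaging twice in each step. Many tails \<open>y\<close>
  admit a positive proportion of letters \<open>v\<close> with \<open>H (v # y)\<close>, so a
  positive proportion of the pairs of a block \<open>w\<close> and a tail \<open>y\<close> are
  compatible in every letter of \<open>w\<close>. Averaging again, many blocks are compatible with a
  positive proportion of the tails, and among these tails the induction hypothesis finds grids for
  the remaining blocks.\<close>

lemma dense_grids:
  fixes \<epsilon> :: real
  assumes "0 < \<epsilon>"
  shows "\<exists>\<delta>>0::real. \<forall>(V::'a set) H. finite V \<longrightarrow> V \<noteq> {} \<longrightarrow>
    \<epsilon> * card V ^ r \<le> card {y \<in> words V r. H y} \<longrightarrow>
    \<delta> * card V ^ (r * t) \<le> card {xs \<in> words V (r * t). grid t r H xs}"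
  using assms
proof (induction r arbitrary: \<epsilon>)
  case 0
  \<comment> \<open>The empty word is the only word of length 0, and positive density forces
    \<open>H []\<close>; so \<open>\<delta> = 1\<close> works.\<close>
  have "\<epsilon> * card V ^ 0 \<le> card {y \<in> words V 0. H y} \<longrightarrow>
      1 * card V ^ (0 * t) \<le> card {xs \<in> words V (0 * t). grid t 0 H xs}"
    for V :: "'a set" and H
  proof
    assume *: "\<epsilon> * card V ^ 0 \<le> card {y \<in> words V 0. H y}"
    have "H []"
    proof (rule ccontr)
      assume "\<not> H []"
      then have "{y \<in> words V 0. H y} = {}" by auto
      from *[unfolded this] show False using \<open>0 < \<epsilon>\<close> by simp
    qed
    then have "{xs \<in> words V (0 * t). grid t 0 H xs} = {[]}" by auto
    then show "1 * card V ^ (0 * t) \<le> card {xs \<in> words V (0 * t). grid t 0 H xs}"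
      by simp
  qed
  then show ?case by (intro exI[of _ 1]) simp
next
  case (Suc r)
  \<comment> \<open>One factor is the proportion of rich tails, the other \<open>t\<close> are the
    proportions of suitable letters at the places of a block.\<close>
  define \<eta> where "\<eta> = (\<epsilon> / 2) ^ Suc t"
  have \<eta>: "0 < \<eta>" using Suc.prems by (simp add: \<eta>_def)
  obtain \<delta> :: real where \<delta>: "0 < \<delta>" and IH: "\<And>(V::'a set) H. finite V \<Longrightarrow> V \<noteq> {} \<Longrightarrow>
    \<eta> / 2 * card V ^ r \<le> card {y \<in> words V r. H y} \<Longrightarrow>
    \<delta> * card V ^ (r * t) \<le> card {xs \<in> words V (r * t). grid t r H xs}"
    using Suc.IH[of "\<eta> / 2"] \<eta> by auto
  have "\<eta> / 2 * \<delta> * card V ^ (Suc r * t) \<le> card {xs \<in> words V (Suc r * t). grid t (Suc r) H xs}"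
    if fin: "finite V" and ne: "V \<noteq> {}" and dense: "\<epsilon> * card V ^ Suc r \<le> card {y \<in> words V (Suc r). H y}"
    for V :: "'a set" and H
  proof -
    have fw: "finite (words V k)" for k
      using fin by (rule finite_lists_length_eq)
    have fwP: "finite {xs \<in> words V k. P xs}" for k P
      by (rule finite_subset[OF _ fw[of k]]) auto
    have cw: "card (words V k) = card V ^ k" for k
      using fin by (rule card_lists_length_eq)
    have wne: "words V k \<noteq> {}" for k
      using cw[of k] ne fin by (metis card.empty card_eq_0_iff power_not_zero)
    have "card {y \<in> words V (Suc r). H y} = card {p \<in> words V r \<times> V. H (snd p # fst p)}"
      by (rule bij_betw_same_card[of "\<lambda>y. (tl y, hd y)"], rule bij_betw_byWitness[where f' = "\<lambda>p. snd p # fst p"])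
         (auto simp: length_Suc_conv)
    then have "\<epsilon> / 2 * card (words V r) \<le> card {y \<in> words V r. \<epsilon> / 2 * card V \<le> card {v \<in> V. H (v # y)}}"
      using dense \<open>0 < \<epsilon>\<close> fin ne fw cw by (intro card_dense_fibres) (auto simp: ac_simps)
    moreover have "card {y \<in> words V r. \<epsilon> / 2 * card V \<le> card {v \<in> V. H (v # y)}} * (\<epsilon> / 2 * card V) ^ t
        \<le> card (SIGMA y:words V r. words {v \<in> V. H (v # y)} t)"
    proof -
      let ?Y = "{y \<in> words V r. \<epsilon> / 2 * card V \<le> card {v \<in> V. H (v # y)}}"
      have "card ?Y * (\<epsilon> / 2 * card V) ^ t = (\<Sum>y\<in>?Y. (\<epsilon> / 2 * card V) ^ t)"
        by simp
      also have "\<dots> \<le> (\<Sum>y\<in>?Y. real (card (words {v \<in> V. H (v # y)} t)))"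
      proof (rule sum_mono)
        fix y assume y: "y \<in> ?Y"
        have "card (words {v \<in> V. H (v # y)} t) = card {v \<in> V. H (v # y)} ^ t"
          using fin by (intro card_lists_length_eq) auto
        then show "(\<epsilon> / 2 * card V) ^ t \<le> real (card (words {v \<in> V. H (v # y)} t))"
          using y \<open>0 < \<epsilon>\<close> by (auto intro!: power_mono)
      qed
      also have "\<dots> \<le> (\<Sum>y\<in>words V r. real (card (words {v \<in> V. H (v # y)} t)))"
        using fw by (intro sum_mono2) auto
      also have "\<dots> = card (SIGMA y:words V r. words {v \<in> V. H (v # y)} t)"
        using fw fin by (subst card_SigmaI) (auto intro!: finite_lists_length_eq)
      finally show ?thesis .
    qed
    ultimately have "\<epsilon> / 2 * card (words V r) * (\<epsilon> / 2 * card V) ^ t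
        \<le> card (SIGMA y:words V r. words {v \<in> V. H (v # y)} t)"
      using \<open>0 < \<epsilon>\<close> by (meson mult_right_mono order_trans zero_le_power divide_nonneg_nonneg mult_nonneg_nonneg of_nat_0_le_iff less_imp_le zero_le_numeral)
    \<comment> \<open>Count the same compatible pairs from the side of the blocks.\<close>
    also have "card (SIGMA y:words V r. words {v \<in> V. H (v # y)} t)
        = card {p \<in> words V t \<times> words V r. \<forall>s<t. H (fst p ! s # snd p)}"
      by (rule bij_betw_same_card[of prod.swap], rule bij_betw_byWitness[where f' = prod.swap])
         (auto simp: set_conv_nth subset_iff)
    finally have "\<eta> * card (words V t) * card (words V r)
        \<le> card {p \<in> words V t \<times> words V r. \<forall>s<t. H (fst p ! s # snd p)}"
      by (simp add: \<eta>_def cw power_mult_distrib power_divide mult_ac)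
    then have G: "\<eta> / 2 * card (words V t) \<le> card {w \<in> words V t. \<eta> / 2 * card (words V r) \<le>
        card {y \<in> words V r. \<forall>s<t. H (w ! s # y)}}" (is "_ \<le> real (card ?G)")
      using \<eta> fw wne by (intro card_dense_fibres) auto
    have "\<eta> / 2 * \<delta> * card V ^ (Suc r * t) = (\<eta> / 2 * card (words V t)) * (\<delta> * card V ^ (r * t))"
      by (simp add: cw power_add)
    also have "\<dots> \<le> card ?G * (\<delta> * card V ^ (r * t))"
      using G \<delta> by (intro mult_right_mono) auto
    also have "\<dots> = (\<Sum>w\<in>?G. \<delta> * card V ^ (r * t))"
      by simp
    also have "\<dots> \<le> (\<Sum>w\<in>?G. real (card {xs \<in> words V (r * t). grid t r (\<lambda>y. \<forall>s<t. H (w ! s # y)) xs}))"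
      using fin ne by (intro sum_mono IH) (auto simp: cw)
    also have "\<dots> = card (SIGMA w:?G. {xs \<in> words V (r * t). grid t r (\<lambda>y. \<forall>s<t. H (w ! s # y)) xs})"
      using fwP by (subst card_SigmaI) auto
    also have "\<dots> = card ((\<lambda>(w, xs). w @ xs) ` (SIGMA w:?G. {xs \<in> words V (r * t). grid t r (\<lambda>y. \<forall>s<t. H (w ! s # y)) xs}))"
      by (subst card_image) (auto simp: inj_on_def)
    also have "\<dots> \<le> card {xs \<in> words V (Suc r * t). grid t (Suc r) H xs}"
    proof -
      have "grid t r (\<lambda>y. \<forall>s<t. H ((w @ xs) ! s # y)) xs = grid t r (\<lambda>y. \<forall>s<t. H (w ! s # y)) xs"
        if "length w = t" for w xs
        using that by (simp add: nth_append cong: conj_cong imp_cong)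
      then show ?thesis
        using fw by (intro of_nat_mono card_mono finite_subset[OF _ fw[of "Suc r * t"]]) auto
    qed
    finally show ?thesis .
  qed
  then show ?case
    using \<eta> \<delta> by (intro exI[of _ "\<eta> / 2 * \<delta>"]) auto
qed

section \<open>Transversals of a list of classes, and subclasses of prescribed size\<close>

lemma Cons_in_set_Cons [simp]: "x # xs \<in> set_Cons V Ws \<longleftrightarrow> x \<in> V \<and> xs \<in> Ws"
  by (simp add: set_Cons_def)

lemma ball_listset_Cons: "(\<forall>S\<in>listset (V # Vs). P S) \<longleftrightarrow> (\<forall>x\<in>V. \<forall>xs\<in>listset Vs. P (x # xs))"
  by (auto simp: set_Cons_def)

lemma finite_listset: "\<forall>V\<in>set Vs. finite V \<Longrightarrow> finite (listset Vs)"
proof (induction Vs)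
  case (Cons V Vs)
  have "listset (V # Vs) = (\<lambda>(v, xs). v # xs) ` (V \<times> listset Vs)"
    by (auto simp: set_Cons_def)
  then show ?case using Cons by simp
qed simp

lemma in_listset_conv_list_all2: "xs \<in> listset Vs \<longleftrightarrow> list_all2 (\<in>) xs Vs"
  by (induction Vs arbitrary: xs) (auto simp: set_Cons_def list_all2_Cons2)

lemma card_listset: "card (listset Vs) = prod_list (map card Vs)"
proof (induction Vs)
  case (Cons V Vs)
  have "listset (V # Vs) = (\<lambda>(v, xs). v # xs) ` (V \<times> listset Vs)"
    by (auto simp: set_Cons_def)
  moreover have "card \<dots> = card (V \<times> listset Vs)"
    by (rule card_image) (auto simp: inj_on_def)
  ultimately show ?case using Cons by (simp add: card_cartesian_product)
qed simp

lemma listset_mono: "list_all2 (\<subseteq>) Ws Vs \<Longrightarrow> listset Ws \<subseteq> listset Vs"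
  by (induction rule: list_all2_induct) (auto simp: set_Cons_def)

abbreviation subclasses :: "nat \<Rightarrow> nat set list \<Rightarrow> nat set list \<Rightarrow> bool" where
  "subclasses m \<equiv> list_all2 (\<lambda>W V. W \<subseteq> V \<and> card W = m)"

lemma subclasses_exist:
  "\<forall>V\<in>set Vs. m \<le> card V \<Longrightarrow> \<exists>Ws. subclasses m Ws Vs"
proof (induction Vs)
  case (Cons V Vs)
  then obtain Ws where "subclasses m Ws Vs" by auto
  moreover obtain W where "W \<subseteq> V" "card W = m"
    using Cons.prems by (meson list.set_intros(1) obtain_subset_with_card_n)
  ultimately show ?case by (intro exI[of _ "W # Ws"]) auto
qed simp

lemma subclasses_trans:
  "subclasses m Us Ws \<Longrightarrow> subclasses n Ws Vs \<Longrightarrow> subclasses m Us Vs"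
  by (erule list_all2_trans[rotated, of _ _ _ "\<lambda>W V. W \<subseteq> V \<and> card W = n"]) auto

lemma subclasses_card: "subclasses m Ws Vs \<Longrightarrow> W \<in> set Ws \<Longrightarrow> card W = m"
  by (auto simp: list_all2_conv_all_nth in_set_conv_nth)

lemma subclasses_subset: "subclasses m Ws Vs \<Longrightarrow> list_all2 (\<subseteq>) Ws Vs"
  by (erule list_all2_mono) auto

lemma card_listset_const: "\<forall>V\<in>set Vs. card V = n \<Longrightarrow> card (listset Vs) = n ^ length Vs"
  unfolding card_listset by (induction Vs) auto

section \<open>Ramsey-type selection of homogeneous classes\<close>

text \<open>Each element of \<open>V\<close> induces one of at most \<open>L ^ M\<close> colour
  patterns on \<open>X\<close>; by the pigeonhole principle \<open>m\<close> elements share a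
  pattern.\<close>

lemma homogeneous_first_coordinate:
  fixes g :: "'a \<Rightarrow> 'x \<Rightarrow> nat"
  assumes "finite X" "\<And>a x. a \<in> V \<Longrightarrow> x \<in> X \<Longrightarrow> g a x < L" "card X \<le> M" "0 < m" "m * L ^ M \<le> card V" "0 < L"
  shows "\<exists>W a. W \<subseteq> V \<and> card W = m \<and> a \<in> W \<and> (\<forall>b\<in>W. \<forall>x\<in>X. g b x = g a x)"
proof -
  have V: "finite V" "V \<noteq> {}"
    using assms by (metis card.empty card.infinite le_zero_eq mult_eq_0_iff not_less_zero power_not_zero neq0_conv)+
  let ?B = "X \<rightarrow>\<^sub>E {..<L}"
  have "card ?B * m \<le> card V"
  proof -
    have "card ?B = L ^ card X" using assms by (simp add: card_PiE)
    also have "\<dots> \<le> L ^ M" using assms by (intro power_increasing) auto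
    finally show ?thesis using assms(5) by (metis mult.commute mult_le_mono2 order_trans)
  qed
  moreover have maps: "(\<lambda>a. restrict (g a) X) \<in> V \<rightarrow> ?B"
    using assms(2) by (intro Pi_I) simp
  moreover have B: "finite ?B" "?B \<noteq> {}"
    using assms(1) maps V(2) by (auto intro: finite_PiE)
  ultimately obtain p where "card ?B * m \<le> card ((\<lambda>a. restrict (g a) X) -` {p} \<inter> V) * card ?B"
    using pigeonhole_card[OF maps V(1) B] order_trans by blast
  then have p: "m \<le> card ((\<lambda>a. restrict (g a) X) -` {p} \<inter> V)"
    using B by (simp add: mult.commute card_gt_0_iff del: card_PiE)
  then obtain W where W: "W \<subseteq> (\<lambda>a. restrict (g a) X) -` {p} \<inter> V" "card W = m"
    by (meson obtain_subset_with_card_n)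
  then obtain a where a: "a \<in> W" using \<open>0 < m\<close> by fastforce
  have "g b x = g a x" if "b \<in> W" "x \<in> X" for b x
  proof -
    have "restrict (g b) X = restrict (g a) X" using W a that by auto
    then show ?thesis using that by (metis restrict_apply')
  qed
  then show ?thesis using W a by blast
qed

text \<open>Induction on the number of classes: cut the later classes to bounded size, make the
  colour independent of the member of the first class, and apply the induction hypothesis to the
  colouring obtained by fixing one such member.\<close>

lemma box_ramsey:
  assumes "0 < t" "0 < L"
  shows "\<exists>N. \<forall>Vs. length Vs = r \<longrightarrow> (\<forall>V\<in>set Vs. N \<le> card V) \<longrightarrow>
    (\<forall>g. (\<forall>S\<in>listset Vs. g S < L) \<longrightarrow>
      (\<exists>Ws c. subclasses t Ws Vs \<and> (\<forall>S\<in>listset Ws. g S = (c::nat))))"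
proof (induction r)
  case 0
  then show ?case by auto
next
  case (Suc r)
  then obtain N where N: "\<And>Vs g. length Vs = r \<Longrightarrow> \<forall>V\<in>set Vs. N \<le> card V \<Longrightarrow>
    \<forall>S\<in>listset Vs. g S < L \<Longrightarrow> \<exists>Ws c. subclasses t Ws Vs \<and> (\<forall>S\<in>listset Ws. g S = (c::nat))"
    by blast
  \<comment> \<open>Later classes cut to \<open>max 1 N\<close> members have
    \<open>max 1 N ^ r\<close> transversals, which is the exponent in the number of colour patterns.
    The lower bound 1 keeps the cut classes finite, since infinite sets have cardinality 0.\<close>
  let ?N = "max (max 1 N) (t * L ^ (max 1 N ^ r))"
  show ?case
  proof (intro exI[of _ ?N] allI impI)
    fix Vs and g :: "nat list \<Rightarrow> nat"
    assume "length Vs = Suc r" and c: "\<forall>V\<in>set Vs. ?N \<le> card V" and g: "\<forall>S\<in>listset Vs. g S < L"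
    then obtain V Vs' where Vs: "Vs = V # Vs'" and len: "length Vs' = r"
      by (cases Vs) auto
    obtain Us where Us: "subclasses (max 1 N) Us Vs'"
      using subclasses_exist[of Vs' "max 1 N"] c Vs by force
    have cU: "\<forall>U\<in>set Us. card U = max 1 N" using subclasses_card[OF Us] by blast
    have lU: "length Us = r" using Us len by (auto dest: list_all2_lengthD)
    have sub: "listset Us \<subseteq> listset Vs'" using Us by (intro listset_mono subclasses_subset)
    have "\<exists>W a. W \<subseteq> V \<and> card W = t \<and> a \<in> W \<and> (\<forall>b\<in>W. \<forall>T\<in>listset Us. g (b # T) = g (a # T))"
    proof (rule homogeneous_first_coordinate)
      show "finite (listset Us)"
        using cU by (intro finite_listset) (metis card.infinite max_0_1(2) max.cobounded1 not_one_le_zero)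
      show "card (listset Us) \<le> max 1 N ^ r"
        using card_listset_const[OF cU] lU by simp
      show "g (b # T) < L" if "b \<in> V" "T \<in> listset Us" for b T
        using g that sub unfolding Vs ball_listset_Cons by blast
    qed (use assms c Vs in auto)
    then obtain W a where W: "W \<subseteq> V" "card W = t" "a \<in> W"
      and hom: "\<And>b T. b \<in> W \<Longrightarrow> T \<in> listset Us \<Longrightarrow> g (b # T) = g (a # T)"
      by blast
    have "\<forall>S\<in>listset Us. g (a # S) < L"
      using g W sub unfolding Vs ball_listset_Cons by blast
    then obtain Ws k where Ws: "subclasses t Ws Us" "\<forall>S\<in>listset Ws. g (a # S) = k"
      using N[of Us "\<lambda>S. g (a # S)"] lU cU by auto
    have "listset Ws \<subseteq> listset Us" using Ws by (intro listset_mono subclasses_subset)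
    then have "\<forall>S\<in>listset (W # Ws). g S = k"
      using hom Ws unfolding ball_listset_Cons by (metis subsetD)
    moreover have "subclasses t (W # Ws) Vs"
      using W subclasses_trans[OF Ws(1) Us] by (simp add: Vs)
    ultimately show "\<exists>Ws c. subclasses t Ws Vs \<and> (\<forall>S\<in>listset Ws. g S = c)"
      by blast
  qed
qed

text \<open>Treat the first class as huge compared to the others: the colours for the other classes then become independent
  of its members, after which the other classes are thinned out so that the colour for the first class is constant.\<close>

lemma homogeneous_classes:
  assumes "0 < m" "0 < L"
  shows "\<exists>N. \<forall>Vs. length Vs = r \<longrightarrow> (\<forall>V\<in>set Vs. N \<le> card V) \<longrightarrow>
    (\<forall>g. (\<forall>i<r. \<forall>S\<in>listset Vs. \<forall>J\<subseteq>Vs ! i. g i S J < L) \<longrightarrow>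
      (\<exists>Js. subclasses m Js Vs \<and>
        (\<forall>i<r. \<exists>j\<in>Js ! i. \<exists>c. \<forall>S\<in>listset Js. S ! i = j \<longrightarrow> g i S (Js ! i) = (c::nat))))"
proof (induction r)
  case 0
  then show ?case by auto
next
  case (Suc r)
  then obtain N where "\<forall>Vs. length Vs = r \<longrightarrow> (\<forall>V\<in>set Vs. N \<le> card V) \<longrightarrow>
    (\<forall>g. (\<forall>i<r. \<forall>S\<in>listset Vs. \<forall>J\<subseteq>Vs ! i. g i S J < L) \<longrightarrow>
      (\<exists>Js. subclasses m Js Vs \<and>
        (\<forall>i<r. \<exists>j\<in>Js ! i. \<exists>c. \<forall>S\<in>listset Js. S ! i = j \<longrightarrow> g i S (Js ! i) = (c::nat))))"
    by (rule exE)
  note N = this[THEN spec, THEN mp, THEN mp, THEN spec, THEN mp]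
  define N' where "N' = max 1 N"
  obtain B where B: "\<And>Vs g. length Vs = r \<Longrightarrow> \<forall>V\<in>set Vs. B \<le> card V \<Longrightarrow>
    \<forall>S\<in>listset Vs. g S < L \<Longrightarrow> \<exists>Ws c. subclasses N' Ws Vs \<and> (\<forall>S\<in>listset Ws. g S = (c::nat))"
    using box_ramsey[of N' L r] assms unfolding N'_def by fastforce
  define B' where "B' = max 1 B"
  \<comment> \<open>Once the later classes are cut to \<open>B'\<close> members, this counts the
    triples of a later class, a transversal and a subset of that class, on which the first class
    induces colour patterns.\<close>
  define M where "M = r * (B' ^ r * 2 ^ B')"
  let ?N = "max B' (m * L ^ M)"
  show ?case
  proof (intro exI[of _ ?N] allI impI)
    fix Vs and g :: "nat \<Rightarrow> nat list \<Rightarrow> nat set \<Rightarrow> nat"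
    assume "length Vs = Suc r" and c: "\<forall>V\<in>set Vs. ?N \<le> card V"
      and g: "\<forall>i<Suc r. \<forall>S\<in>listset Vs. \<forall>J\<subseteq>Vs ! i. g i S J < L"
    then obtain V Vs' where Vs: "Vs = V # Vs'" and len: "length Vs' = r"
      by (cases Vs) auto
    obtain Us where Us: "subclasses B' Us Vs'"
      using subclasses_exist[of Vs' B'] c Vs by force
    have cU: "\<forall>U\<in>set Us. card U = B'" using subclasses_card[OF Us] by blast
    have fU: "\<forall>U\<in>set Us. finite U"
      using cU unfolding B'_def by (metis card.infinite max.cobounded1 not_one_le_zero)
    have lU: "length Us = r" using Us len by (auto dest: list_all2_lengthD)
    have sub: "listset Us \<subseteq> listset Vs'" using Us by (intro listset_mono subclasses_subset)
    have subnth: "Us ! i \<subseteq> Vs' ! i" if "i < r" for i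
      using Us that lU by (auto simp: list_all2_conv_all_nth)
    define X where "X = (SIGMA i:{..<r}. listset Us \<times> Pow (Us ! i))"
    define h where "h b x = (case x of (i, T, J) \<Rightarrow> g (Suc i) (b # T) J)" for b x
    have fX: "finite X"
      using fU lU finite_listset[OF fU] by (auto simp: X_def)
    have "card X = (\<Sum>i<r. B' ^ r * 2 ^ B')"
      unfolding X_def using fU lU cU finite_listset[OF fU] card_listset_const[OF cU]
      by (subst card_SigmaI) (auto simp: card_cartesian_product card_Pow)
    then have cX: "card X \<le> M" by (simp add: M_def)
    have "\<exists>W a. W \<subseteq> V \<and> card W = m \<and> a \<in> W \<and> (\<forall>b\<in>W. \<forall>x\<in>X. h b x = h a x)"
    proof (rule homogeneous_first_coordinate[OF fX _ cX])
      show "h b x < L" if "b \<in> V" and x_in: "x \<in> X" for b x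
      proof -
        obtain i T J where x: "x = (i, T, J)" "i < r" "T \<in> listset Us" "J \<subseteq> Us ! i"
          using x_in by (auto simp: X_def)
        then have "b # T \<in> listset Vs" "J \<subseteq> Vs ! Suc i"
          using \<open>b \<in> V\<close> sub subnth[of i] by (auto simp: Vs)
        then show ?thesis using g x by (simp add: h_def)
      qed
    qed (use assms c Vs in auto)
    then obtain W a where W: "W \<subseteq> V" "card W = m" "a \<in> W"
      and hom: "\<And>b x. b \<in> W \<Longrightarrow> x \<in> X \<Longrightarrow> h b x = h a x"
      by blast
    have "\<forall>T\<in>listset Us. g 0 (a # T) W < L"
    proof
      fix T assume "T \<in> listset Us"
      then have "a # T \<in> listset Vs" using W sub by (auto simp: Vs)
      then show "g 0 (a # T) W < L" using g W(1) by (simp add: Vs)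
    qed
    then obtain Ws k where Ws: "subclasses N' Ws Us" "\<forall>T\<in>listset Ws. g 0 (a # T) W = k"
      using B[of Us "\<lambda>T. g 0 (a # T) W"] lU cU unfolding B'_def by auto
    have lW: "length Ws = r" using Ws lU by (auto dest: list_all2_lengthD)
    have subW: "listset Ws \<subseteq> listset Us" using Ws by (intro listset_mono subclasses_subset)
    have subWnth: "Ws ! i \<subseteq> Us ! i" if "i < r" for i
      using Ws that lW by (auto simp: list_all2_conv_all_nth)
    have "\<forall>i<r. \<forall>T\<in>listset Ws. \<forall>J\<subseteq>Ws ! i. g (Suc i) (a # T) J < L"
    proof (intro allI impI ballI)
      fix i T J assume "i < r" "T \<in> listset Ws" "J \<subseteq> Ws ! i"
      then have "a # T \<in> listset Vs" "J \<subseteq> Vs ! Suc i"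
        using W sub subW subnth[of i] subWnth[of i] by (auto simp: Vs)
      then show "g (Suc i) (a # T) J < L" using g \<open>i < r\<close> by simp
    qed
    moreover have "\<forall>W\<in>set Ws. N \<le> card W" using subclasses_card[OF Ws(1)] by (auto simp: N'_def)
    ultimately obtain Js where Js: "subclasses m Js Ws" and
      mono: "\<forall>i<r. \<exists>j\<in>Js ! i. \<exists>c. \<forall>T\<in>listset Js. T ! i = j \<longrightarrow> g (Suc i) (a # T) (Js ! i) = c"
      using N[of Ws "\<lambda>i T J. g (Suc i) (a # T) J", OF lW] by blast
    have subJ: "listset Js \<subseteq> listset Ws" using Js by (intro listset_mono subclasses_subset)
    have subJnth: "Js ! i \<subseteq> Us ! i" if "i < r" for i
      using Js that lW subWnth by (fastforce simp: list_all2_conv_all_nth)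
    have "\<exists>j\<in>(W # Js) ! i. \<exists>c. \<forall>S\<in>listset (W # Js). S ! i = j \<longrightarrow> g i S ((W # Js) ! i) = c"
      if "i < Suc r" for i
    proof (cases i)
      case 0
      then show ?thesis
        using W Ws subJ by (auto simp: set_Cons_def intro!: bexI[of _ a] exI[of _ k])
    next
      case (Suc i')
      then have i': "i' < r" using that by simp
      obtain j where j: "j \<in> Js ! i'" and
        "\<exists>c. \<forall>T\<in>listset Js. T ! i' = j \<longrightarrow> g (Suc i') (a # T) (Js ! i') = c"
        using mono[THEN spec, THEN mp, OF i'] by (rule bexE)
      then obtain k where "\<forall>T\<in>listset Js. T ! i' = j \<longrightarrow> g (Suc i') (a # T) (Js ! i') = k"
        by (elim exE)
      note k = this[THEN bspec, THEN mp]
      \<comment> \<open>The induction hypothesis gives constancy only for transversals that start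
        with \<open>a\<close>; homogeneity in the first member extends it to all of
        \<open>W\<close>.\<close>
      have "g (Suc i') (b # T) (Js ! i') = k" if "b \<in> W" "T \<in> listset Js" "T ! i' = j" for b T
        using hom[of b "(i', T, Js ! i')"] that i' subJ subW subJnth[OF i'] k[OF that(2,3)]
        by (auto simp: X_def h_def)
      then show ?thesis
        using Suc j by (auto simp: set_Cons_def intro!: bexI[of _ j] exI[of _ k])
    qed
    moreover have "subclasses m (W # Js) Vs"
      using W subclasses_trans[OF subclasses_trans[OF Js Ws(1)] Us] by (simp add: Vs)
    ultimately show "\<exists>Js. subclasses m Js Vs \<and>
        (\<forall>i<Suc r. \<exists>j\<in>Js ! i. \<exists>c. \<forall>S\<in>listset Js. S ! i = j \<longrightarrow> g i S (Js ! i) = c)"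
      by blast
  qed
qed

section \<open>The colourful Helly theorem\<close>

text \<open>An indexed family may repeat sets or be small. Helly's theorem applies to the set of
  distinct members once there are enough of them, and an injective choice of indices turns each
  subfamily into an index set of the same size.\<close>

lemma Helly_indexed:
  fixes A :: "'i \<Rightarrow> 'a::euclidean_space set"
  assumes fin: "finite I" and conv: "\<And>i. i \<in> I \<Longrightarrow> convex (A i)"
    and small: "\<And>J. J \<subseteq> I \<Longrightarrow> card J \<le> DIM('a) + 1 \<Longrightarrow> (\<Inter>i\<in>J. A i) \<noteq> {}"
  shows "(\<Inter>i\<in>I. A i) \<noteq> {}"
proof -
  have lift: "\<exists>J\<subseteq>I. A ` J = f \<and> card J = card f" if f: "f \<subseteq> A ` I" for f
  proof -
    obtain J where "J \<subseteq> I" "inj_on A J" "A ` J = f"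
      using f unfolding subset_image_inj by blast
    then show ?thesis using card_image[of A J] by auto
  qed
  show ?thesis
  proof (cases "DIM('a) + 1 \<le> card (A ` I)")
    case True
    have "\<Inter>(A ` I) \<noteq> {}"
    proof (rule Helly[OF True])
      show "\<forall>s\<in>A ` I. convex s" using conv by auto
      show "\<Inter>t \<noteq> {}" if "t \<subseteq> A ` I" "card t = DIM('a) + 1" for t
        using lift[OF that(1)] small that(2) by force
    qed
    then show ?thesis .
  next
    case False
    then obtain J where "J \<subseteq> I" "A ` J = A ` I" "card J \<le> DIM('a) + 1"
      using lift[of "A ` I"] by auto
    then show ?thesis using small[of J] by simp
  qed
qed

text \<open>Among all transversals take one, \<open>S\<close>, whose intersection is farthest from the origin. By Helly's theorem
  that distance is already enforced by all but one of its members; swapping the redundant one for any other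
  set of the same class neither increases nor decreases the distance, so the nearest point does not move.\<close>

lemma colourful_Helly:
  fixes C :: "nat \<Rightarrow> nat \<Rightarrow> 'a::euclidean_space set"
  assumes len: "length Js = DIM('a) + 1" and fin: "\<And>J. J \<in> set Js \<Longrightarrow> finite J \<and> J \<noteq> {}"
    and conv: "\<And>i j. convex (C i j)" and comp: "\<And>i j. compact (C i j)"
    and meet: "\<And>S. S \<in> listset Js \<Longrightarrow> (\<Inter>i<DIM('a) + 1. C i (S ! i)) \<noteq> {}"
  shows "\<exists>i<DIM('a) + 1. (\<Inter>j\<in>Js ! i. C i j) \<noteq> {}"
proof -
  define K where "K S = (\<Inter>i<DIM('a) + 1. C i (S ! i))" for S
  have "\<exists>x\<in>K S. \<forall>y\<in>K S. norm x \<le> norm y" if "S \<in> listset Js" for S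
  proof -
    have "closed (K S)" unfolding K_def using comp by (auto intro: compact_imp_closed)
    moreover have "K S \<noteq> {}" using meet[OF that] by (simp add: K_def)
    ultimately obtain z where "z \<in> K S" "\<And>y. y \<in> K S \<Longrightarrow> dist 0 z \<le> dist 0 y"
      using distance_attains_inf by metis
    then show ?thesis by auto
  qed
  then obtain x where x: "\<And>S. S \<in> listset Js \<Longrightarrow> x S \<in> K S"
    and xmin: "\<And>S y. S \<in> listset Js \<Longrightarrow> y \<in> K S \<Longrightarrow> norm (x S) \<le> norm y"
    by metis
  have "finite (listset Js)" using fin by (intro finite_listset) auto
  moreover have "listset Js \<noteq> {}"
  proof -
    have "map (\<lambda>J. SOME j. j \<in> J) Js \<in> listset Js"
      using fin by (auto simp: in_listset_conv_list_all2 list_all2_conv_all_nth some_in_eq)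
    then show ?thesis by auto
  qed
  ultimately obtain S where S: "S \<in> listset Js" and Smax: "\<And>T. T \<in> listset Js \<Longrightarrow> norm (x T) \<le> norm (x S)"
    using obtains_MAX[of "listset Js" "\<lambda>S. norm (x S)"] by (metis Max_ge finite_imageI imageI)
  \<comment> \<open>\<open>None\<close> stands for the open ball that reaches up to
    \<open>x S\<close>; it misses \<open>K S\<close> because \<open>x S\<close> is a point of
    \<open>K S\<close> nearest to the origin.\<close>
  define A where "A o' = (case o' of None \<Rightarrow> ball 0 (norm (x S)) | Some i \<Rightarrow> C i (S ! i))" for o'
  define I where "I = insert None (Some ` {..<DIM('a) + 1})"
  have "(\<Inter>i\<in>I. A i) = {}"
    using xmin[OF S] unfolding I_def A_def K_def by force
  then obtain J where J: "J \<subseteq> I" "card J \<le> DIM('a) + 1" "(\<Inter>i\<in>J. A i) = {}"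
    using Helly_indexed[of I A] conv by (fastforce simp: I_def A_def split: option.splits)
  \<comment> \<open>All members of \<open>S\<close> contain \<open>x S\<close>, so a subfamily with
    empty intersection must use the ball. That leaves room in \<open>J\<close> for at most
    \<open>DIM('a)\<close> of the \<open>DIM('a) + 1\<close> members of \<open>S\<close>.\<close>
  have "None \<in> J"
  proof (rule ccontr)
    assume "None \<notin> J"
    then have "x S \<in> (\<Inter>i\<in>J. A i)"
      using x[OF S] J(1) by (auto simp: I_def A_def K_def)
    then show False using J by simp
  qed
  have "\<not> Some ` {..<DIM('a) + 1} \<subseteq> J"
  proof
    assume "Some ` {..<DIM('a) + 1} \<subseteq> J"
    then have "J = I" using J(1) \<open>None \<in> J\<close> by (auto simp: I_def)
    moreover have "card I = DIM('a) + 2" by (simp add: I_def card_image)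
    ultimately show False using J(2) by simp
  qed
  then obtain i where i: "i < DIM('a) + 1" "Some i \<notin> J" by auto
  define L where "L = (\<Inter>k\<in>{..<DIM('a) + 1} - {i}. C k (S ! k))"
  have L: "convex L" "closed L"
    unfolding L_def by (intro convex_INT conv, intro closed_INT ballI compact_imp_closed comp)
  have far: "norm (x S) \<le> norm y" if "y \<in> L" for y
  proof (rule ccontr)
    assume near: "\<not> ?thesis"
    have "y \<in> A o'" if o': "o' \<in> J" for o'
    proof (cases o')
      case None
      then show ?thesis using near by (simp add: A_def)
    next
      case (Some k)
      then have "k < DIM('a) + 1" "k \<noteq> i" using o' J(1) i(2) by (auto simp: I_def)
      then show ?thesis using Some \<open>y \<in> L\<close> by (simp add: A_def L_def)
    qed
    then have "y \<in> (\<Inter>i\<in>J. A i)" by blast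
    then show False using J by simp
  qed
  have "x S \<in> C i j" if j: "j \<in> Js ! i" for j
  proof -
    let ?T = "S[i := j]"
    have T: "?T \<in> listset Js"
      using S j by (auto simp: in_listset_conv_list_all2 list_all2_conv_all_nth)
        (metis nth_list_update_eq nth_list_update_neq)
    have lS: "length S = DIM('a) + 1" using S len by (auto simp: in_listset_conv_list_all2 dest: list_all2_lengthD)
    have xT: "x ?T \<in> L" "x ?T \<in> C i j"
      using x[OF T] i lS by (auto simp: K_def L_def nth_list_update split: if_splits)
    \<comment> \<open>Both points lie in the closed convex set \<open>L\<close> and are nearest to
      the origin there: \<open>x ?T\<close> is no farther than \<open>x S\<close> by the maximality
      of \<open>S\<close>, and \<open>x S\<close> is minimal in \<open>L\<close> by
      \<open>far\<close>.\<close>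
    have "x S = x ?T"
    proof (rule any_closest_point_unique[OF L(1,2), of _ _ 0])
      show "x S \<in> L" using x[OF S] by (auto simp: K_def L_def)
      show "x ?T \<in> L" by (rule xT)
      show "\<forall>z\<in>L. dist 0 (x S) \<le> dist 0 z" using far by simp
      show "\<forall>z\<in>L. dist 0 (x ?T) \<le> dist 0 z" using far Smax[OF T] by force
    qed
    then show ?thesis using xT by simp
  qed
  then show ?thesis using i by blast
qed

section \<open>Approximating convex bodies by parallelepipeds\<close>

lemma compact_vectors_of: "compact K \<Longrightarrow> compact {X :: ('a::euclidean_space)^'n. \<forall>k. X $ k \<in> K}"
proof -
  assume K: "compact K"
  then obtain B where B: "\<And>x. x \<in> K \<Longrightarrow> norm x \<le> B"
    by (meson bounded_iff compact_imp_bounded)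
  have "norm X \<le> (\<Sum>k\<in>(UNIV::'n set). B)" if "\<forall>k. X $ k \<in> K" for X :: "'a^'n"
  proof -
    have "norm X \<le> (\<Sum>k\<in>UNIV. norm (X $ k))"
      unfolding norm_vec_def by (rule L2_set_le_sum) simp
    also have "\<dots> \<le> (\<Sum>k\<in>(UNIV::'n set). B)"
      using that B by (intro sum_mono) auto
    finally show ?thesis .
  qed
  then have "bounded {X :: 'a^'n. \<forall>k. X $ k \<in> K}"
    unfolding bounded_iff by blast
  moreover have "closed {X :: 'a^'n. \<forall>k. X $ k \<in> K}"
  proof -
    have "{X :: 'a^'n. \<forall>k. X $ k \<in> K} = (\<Inter>k. (\<lambda>X. X $ k) -` K)" by auto
    then show ?thesis
      using K by (simp only:) (intro closed_INT ballI closed_vimage_vec_nth compact_imp_closed)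
  qed
  ultimately show ?thesis by (simp add: compact_eq_bounded_closed)
qed

text \<open>The frame \<open>x0, A\<close> spans a simplex of maximal volume with vertices in \<open>K\<close>; by Cramer's rule the
  coordinates of the points of \<open>K\<close> in this frame are bounded by 1.\<close>

lemma maximal_frame:
  fixes K :: "(real^'n) set"
  assumes comp: "compact K" and int: "interior K \<noteq> {}"
  obtains x0 and A :: "real^'n^'n" where "x0 \<in> K" "\<And>k. x0 + column k A \<in> K" "det A \<noteq> 0"
    "\<And>x. x \<in> K \<Longrightarrow> \<exists>y. (\<forall>k. \<bar>y $ k\<bar> \<le> 1) \<and> x = x0 + A *v y"
proof -
  define M :: "(real^'n) \<times> ((real^'n)^'n) \<Rightarrow> real^'n^'n"
    where "M p = (\<chi> i k. snd p $ k $ i - fst p $ i)" for p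
  let ?D = "\<lambda>p. \<bar>det (M p)\<bar>"
  let ?S = "K \<times> {X. \<forall>k. X $ k \<in> K}"
  obtain c e where ce: "0 < e" "cball c e \<subseteq> K"
    using int by (auto simp: mem_interior_cball)
  \<comment> \<open>A small nondegenerate simplex inside \<open>K\<close> shows that the maximal
    determinant is not 0.\<close>
  define X where "X = (\<chi> k. c + e *s axis k (1::real))"
  have "norm (e *s axis k (1::real) :: real^'n) \<le> e" for k
    using ce by (simp add: scalar_mult_eq_scaleR)
  then have X: "(c, X) \<in> ?S"
    using ce by (auto simp: X_def dist_norm subset_iff)
  have "compact ?S"
    using comp by (intro compact_Times compact_vectors_of)
  moreover have "continuous_on ?S ?D"
    unfolding det_def M_def by (intro continuous_intros)
  ultimately obtain p where p: "p \<in> ?S" and max: "\<And>q. q \<in> ?S \<Longrightarrow> ?D q \<le> ?D p"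
    using continuous_attains_sup[of ?S ?D] X by blast
  have "M (c, X) = (\<chi> i. e *s mat 1 $ i)"
    by (simp add: M_def X_def vec_eq_iff axis_def mat_def)
  then have "det (M (c, X)) = e ^ CARD('n)"
    by (simp add: det_rows_mul)
  then have "0 < ?D (c, X)"
    using ce by simp
  with max[OF X] have "0 < ?D p" by (rule less_le_trans[rotated])
  then have det: "det (M p) \<noteq> 0" by simp
  show thesis
  proof
    show "fst p \<in> K" "det (M p) \<noteq> 0"
      using p det by auto
    show "fst p + column k (M p) \<in> K" for k
    proof -
      have "fst p + column k (M p) = snd p $ k"
        by (simp add: M_def column_def vec_eq_iff)
      then show ?thesis using p by auto
    qed
    fix x assume x: "x \<in> K"
    define y where "y = (\<chi> k. det (\<chi> i j. if j = k then (x - fst p) $ i else M p $ i $ j) / det (M p))"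
    have "M p *v y = x - fst p"
      using cramer[OF det, of y "x - fst p"] by (simp add: y_def)
    moreover have "\<bar>y $ k\<bar> \<le> 1" for k
    proof -
      \<comment> \<open>The numerator in Cramer's rule is the determinant of the frame whose vertex
        \<open>k\<close> is moved to \<open>x\<close>; maximality bounds it.\<close>
      let ?q = "(fst p, \<chi> j. if j = k then x else snd p $ j)"
      have q: "?q \<in> ?S" using p x by auto
      have eq: "(\<chi> i j. if j = k then (x - fst p) $ i else M p $ i $ j) = M ?q"
        by (simp add: M_def vec_eq_iff)
      have "\<bar>det (\<chi> i j. if j = k then (x - fst p) $ i else M p $ i $ j)\<bar> \<le> ?D p"
        unfolding eq by (rule max[OF q])
      then show ?thesis using det by (simp add: y_def abs_divide divide_le_eq)
    qed
    ultimately show "\<exists>y. (\<forall>k. \<bar>y $ k\<bar> \<le> 1) \<and> x = fst p + M p *v y"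
      by (intro exI[of _ y]) simp
  qed
qed

lemma convex_frame_simplex:
  fixes K :: "(real^'n) set" and A :: "real^'n^'n"
  assumes "convex K" "x0 \<in> K" "\<And>k. x0 + column k A \<in> K" "\<And>k. 0 \<le> y $ k" "(\<Sum>k\<in>UNIV. y $ k) \<le> 1"
  shows "x0 + A *v y \<in> K"
proof -
  \<comment> \<open>\<open>None\<close> indexes the vertex \<open>x0\<close>, which receives the
    weight that the coordinates leave over.\<close>
  define w where "w o' = (case o' of None \<Rightarrow> 1 - (\<Sum>k\<in>UNIV. y $ k) | Some k \<Rightarrow> y $ k)" for o'
  define z where "z o' = (case o' of None \<Rightarrow> x0 | Some k \<Rightarrow> x0 + column k A)" for o'
  have "(\<Sum>o'\<in>UNIV. w o' *\<^sub>R z o') \<in> K"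
  proof (rule convex_sum)
    show "(\<Sum>o'\<in>UNIV. w o') = 1"
      by (simp add: w_def UNIV_option_conv sum.reindex)
  qed (use assms in \<open>auto simp: w_def z_def split: option.splits\<close>)
  also have "(\<Sum>o'\<in>UNIV. w o' *\<^sub>R z o') = (1 - (\<Sum>k\<in>UNIV. y $ k)) *\<^sub>R x0 + (\<Sum>k\<in>UNIV. y $ k *\<^sub>R (x0 + column k A))"
    by (simp add: w_def z_def UNIV_option_conv sum.reindex)
  also have "\<dots> = x0 + A *v y"
    by (simp add: matrix_mult_sum scaleR_add_right sum.distrib scaleR_diff_left scalar_mult_eq_scaleR
        flip: scaleR_sum_left)
  finally show ?thesis .
qed

lemma convex_frame_cube:
  fixes K :: "(real^'n) set" and A :: "real^'n^'n"
  assumes "convex K" "x0 \<in> K" "\<And>k. x0 + column k A \<in> K" "\<And>k. 0 \<le> y $ k" "\<And>k. y $ k \<le> 1 / CARD('n)"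
  shows "x0 + A *v y \<in> K"
proof -
  have "(\<Sum>k\<in>UNIV. y $ k) \<le> (\<Sum>k\<in>(UNIV::'n set). 1 / CARD('n))"
    using assms by (intro sum_mono) auto
  then show ?thesis
    using assms by (intro convex_frame_simplex) auto
qed

lemma measure_affine_cube:
  fixes A :: "real^'n::{finite,wellorder}^'n::_" and x0 :: "real^'n::{finite,wellorder}"
  assumes "a \<le> b"
  defines "S \<equiv> (+) x0 ` (*v) A ` cbox (\<chi> i. a) (\<chi> i. b)"
  shows "S \<in> lmeasurable" "measure lebesgue S = \<bar>det A\<bar> * (b - a) ^ CARD('n)"
proof -
  let ?Q = "cbox (\<chi> i. a) (\<chi> i. b) :: ((real, 'n) vec) set"
  have "measure lebesgue ?Q = (\<Prod>i\<in>(UNIV :: 'n set). b - a)"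
  proof -
    have "(\<chi> i. a) \<in> ?Q" using assms(1) by (simp add: mem_box_cart)
    then show ?thesis by (auto simp: content_cbox_if_cart)
  qed
  moreover have "linear ((*v) A)" by simp
  ultimately show "S \<in> lmeasurable" "measure lebesgue S = \<bar>det A\<bar> * (b - a) ^ CARD('n)"
    unfolding S_def
    by (auto intro!: measurable_translation measurable_linear_image simp: measure_translation measure_linear_image)
qed

text \<open>With d = \<open>CARD('n)\<close>, the body lies between the affine images of the cubes
  \<open>[0, 1/d]^d\<close> and \<open>[-1, 1]^d\<close>.\<close>

lemma measure_frame_bounds:
  fixes A :: "real^'n::{finite,wellorder}^'n::_"
  assumes "compact K" "convex K" "x0 \<in> K" "\<And>k. x0 + column k A \<in> K"
    "\<And>x. x \<in> K \<Longrightarrow> \<exists>y. (\<forall>k. \<bar>y $ k\<bar> \<le> 1) \<and> x = x0 + A *v y"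
  shows "\<bar>det A\<bar> \<le> real CARD('n) ^ CARD('n) * measure lebesgue K"
    "measure lebesgue K \<le> 2 ^ CARD('n) * \<bar>det A\<bar>"
proof -
  have K: "K \<in> lmeasurable" using assms(1) by (rule lmeasurable_compact)
  let ?I = "(+) x0 ` (*v) A ` cbox (\<chi> i. 0) (\<chi> i. 1 / CARD('n))"
  let ?O = "(+) x0 ` (*v) A ` cbox (\<chi> i. -1) (\<chi> i. 1)"
  have "?I \<subseteq> K"
    using assms by (auto simp: mem_box_cart intro!: convex_frame_cube)
  then have "measure lebesgue ?I \<le> measure lebesgue K"
    using K by (intro measure_mono_fmeasurable) (auto simp: measure_affine_cube fmeasurableD)
  then show "\<bar>det A\<bar> \<le> real CARD('n) ^ CARD('n) * measure lebesgue K"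
    by (simp add: measure_affine_cube power_divide divide_le_eq mult.commute)
  have "K \<subseteq> ?O"
  proof
    fix x assume "x \<in> K"
    then obtain y where "\<forall>k. \<bar>y $ k\<bar> \<le> 1" "x = x0 + A *v y" using assms(5) by blast
    then show "x \<in> ?O" by (intro image_eqI[of _ _ "A *v y"] image_eqI[of _ _ y]) (auto simp: mem_box_cart abs_le_iff)
  qed
  then have "measure lebesgue K \<le> measure lebesgue ?O"
    using K by (intro measure_mono_fmeasurable) (auto simp: measure_affine_cube fmeasurableD)
  then show "measure lebesgue K \<le> 2 ^ CARD('n) * \<bar>det A\<bar>"
    by (simp add: measure_affine_cube mult.commute)
qed

definition polyhedron_of :: "('a::real_inner \<times> real) set \<Rightarrow> 'a set" where
  "polyhedron_of H = {x. \<forall>(a, b)\<in>H. a \<bullet> x \<le> b}"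

text \<open>The image of \<open>[-1, 1]^d\<close> under a maximal frame is a parallelepiped around
  \<open>K\<close>; it exceeds the inscribed image of \<open>[0, 1/d]^d\<close> by the factor
  \<open>(2 * d) ^ d\<close>. A body without interior lies in a hyperplane instead.\<close>

lemma outer_polyhedron:
  fixes K :: "(real^'n::{finite,wellorder}) set"
  assumes "compact K" "convex K"
  obtains H where "finite H" "H \<noteq> {}" "card H \<le> 2 * CARD('n)" "K \<subseteq> polyhedron_of H"
    "polyhedron_of H \<in> lmeasurable"
    "measure lebesgue (polyhedron_of H) \<le> (2 * CARD('n)) ^ CARD('n) * measure lebesgue K"
proof (cases "interior K = {}")
  case True
  then obtain a b where ab: "a \<noteq> 0" "K \<subseteq> {x. a \<bullet> x = b}"
    using empty_interior_subset_hyperplane assms(2) by blast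
  \<comment> \<open>A hyperplane is the intersection of two opposite half-spaces and has volume
    0.\<close>
  have H: "polyhedron_of {(a, b), (- a, - b)} = {x. a \<bullet> x = b}"
    by (auto simp: polyhedron_of_def)
  have "negligible {x. a \<bullet> x = b}" using ab by (intro negligible_hyperplane) auto
  then have "{x. a \<bullet> x = b} \<in> lmeasurable" "measure lebesgue {x. a \<bullet> x = b} = 0"
    by (auto simp: negligible_iff_measure)
  moreover have "card {(a, b), (- a, - b)} \<le> 2 * CARD('n)"
    by (rule order_trans[of _ 2]) (auto simp: card_insert_if Suc_leI)
  ultimately show ?thesis
    using ab H by (intro that[of "{(a, b), (- a, - b)}"]) auto
next
  case False
  then obtain x0 and A :: "((real, 'n) vec, 'n) vec" where A: "x0 \<in> K" "\<And>k. x0 + column k A \<in> K" "det A \<noteq> 0"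
    "\<And>x. x \<in> K \<Longrightarrow> \<exists>y. (\<forall>k. \<bar>y $ k\<bar> \<le> 1) \<and> x = x0 + A *v y"
    using maximal_frame assms(1) by blast
  obtain B where B: "A ** B = mat 1" "B ** A = mat 1"
    using A(3) by (metis invertible_def invertible_det_nz)
  \<comment> \<open>The rows of the inverse matrix are the facet normals: the two half-spaces for
    \<open>k\<close> say that coordinate \<open>k\<close> of \<open>B *v (x - x0)\<close> lies
    between -1 and 1.\<close>
  define H where "H = (\<lambda>k. (B $ k, 1 + B $ k \<bullet> x0)) ` UNIV \<union> (\<lambda>k. (- B $ k, 1 - B $ k \<bullet> x0)) ` UNIV"
  have "card H \<le> card ((\<lambda>k. (B $ k, 1 + B $ k \<bullet> x0)) ` UNIV) + card ((\<lambda>k. (- B $ k, 1 - B $ k \<bullet> x0)) ` UNIV)"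
    unfolding H_def by (rule card_Un_le)
  also have "\<dots> \<le> 2 * CARD('n)"
    by (simp add: mult_2 add_mono card_image_le)
  finally have card: "card H \<le> 2 * CARD('n)" .
  have mem: "x \<in> polyhedron_of H \<longleftrightarrow> (\<forall>k. \<bar>(B *v (x - x0)) $ k\<bar> \<le> 1)" for x
    unfolding polyhedron_of_def H_def matrix_vector_mul_component
    by (auto simp: abs_le_iff inner_diff_right ball_Un algebra_simps)
  have AB: "A *v (B *v x) = x" "B *v (A *v x) = x" for x
    by (simp_all add: matrix_vector_mul_assoc B)
  have "polyhedron_of H = (+) x0 ` (*v) A ` cbox (\<chi> i. -1) (\<chi> i. 1)"
  proof (intro equalityI subsetI)
    fix x assume "x \<in> polyhedron_of H"
    then have "B *v (x - x0) \<in> cbox (\<chi> i. -1) (\<chi> i. 1)"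
      by (auto simp: mem mem_box_cart abs_le_iff minus_le_iff)
    moreover have "x = x0 + A *v (B *v (x - x0))" by (simp add: AB)
    ultimately show "x \<in> (+) x0 ` (*v) A ` cbox (\<chi> i. -1) (\<chi> i. 1)" by blast
  next
    fix x assume "x \<in> (+) x0 ` (*v) A ` cbox (\<chi> i. -1) (\<chi> i. 1)"
    then show "x \<in> polyhedron_of H"
      by (auto simp: mem mem_box_cart AB abs_le_iff minus_le_iff)
  qed
  then have P: "polyhedron_of H \<in> lmeasurable" "measure lebesgue (polyhedron_of H) = \<bar>det A\<bar> * 2 ^ CARD('n)"
    by (simp_all add: measure_affine_cube)
  show ?thesis
  proof (rule that)
    show "K \<subseteq> polyhedron_of H"
    proof
      fix x assume "x \<in> K"
      then obtain y where "\<forall>k. \<bar>y $ k\<bar> \<le> 1" "x = x0 + A *v y" using A by blast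
      then show "x \<in> polyhedron_of H" by (simp add: mem AB)
    qed
    have "measure lebesgue (polyhedron_of H) \<le> (real CARD('n) ^ CARD('n) * measure lebesgue K) * 2 ^ CARD('n)"
      unfolding P using measure_frame_bounds(1)[OF assms A(1,2,4)] by (intro mult_right_mono) auto
    then show "measure lebesgue (polyhedron_of H) \<le> (2 * CARD('n)) ^ CARD('n) * measure lebesgue K"
      by (simp add: power_mult_distrib mult_ac)
  qed (use card P in \<open>auto simp: H_def\<close>)
qed

section \<open>Large subsets of a convex body\<close>

lemma redundant_member:
  fixes A :: "'i \<Rightarrow> (real^'n::{finite,wellorder}) set"
  assumes fin: "finite J" and card: "2 * CARD('n) * (CARD('n) + 1) < card J"
    and A: "\<And>j. j \<in> J \<Longrightarrow> compact (A j)" "\<And>j. j \<in> J \<Longrightarrow> convex (A j)"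
  shows "\<exists>q\<in>J. measure lebesgue (\<Inter>j\<in>J - {q}. A j)
    \<le> (2 * CARD('n)) ^ CARD('n) * measure lebesgue (\<Inter>j\<in>J. A j)"
proof -
  have J: "J \<noteq> {}" using card by auto
  have "compact (\<Inter>j\<in>J. A j)" "convex (\<Inter>j\<in>J. A j)"
    using A J by (auto intro!: convex_INT compact_Inter)
  then obtain H where H: "finite H" "card H \<le> 2 * CARD('n)" "(\<Inter>j\<in>J. A j) \<subseteq> polyhedron_of H"
    "polyhedron_of H \<in> lmeasurable"
    "measure lebesgue (polyhedron_of H) \<le> (2 * CARD('n)) ^ CARD('n) * measure lebesgue (\<Inter>j\<in>J. A j)"
    using outer_polyhedron by metis
  have "\<exists>T. T \<subseteq> J \<and> card T \<le> CARD('n) + 1 \<and> (\<Inter>j\<in>T. A j) \<inter> {x. snd h < fst h \<bullet> x} = {}"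
    if h: "h \<in> H" for h
  proof -
    obtain a b where ab: "h = (a, b)" "(a, b) \<in> H" using h by (cases h) auto
    \<comment> \<open>\<open>None\<close> stands for the open half-space beyond the facet, which the
      whole intersection misses.\<close>
    define B where "B o' = (case o' of None \<Rightarrow> {x. b < a \<bullet> x} | Some j \<Rightarrow> A j)" for o'
    have conv: "convex (B o')" if "o' \<in> insert None (Some ` J)" for o'
      using that A by (auto simp: B_def convex_halfspace_gt)
    have "(\<Inter>o'\<in>insert None (Some ` J). B o') = {}"
      using H(3) ab(2) by (force simp: B_def polyhedron_of_def)
    then obtain I where I: "I \<subseteq> insert None (Some ` J)" "card I \<le> DIM((real, 'n) vec) + 1" "(\<Inter>o'\<in>I. B o') = {}"
      using Helly_indexed[of "insert None (Some ` J)" B] fin conv by blast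
    let ?T = "{j. Some j \<in> I}"
    have "finite I" using I(1) fin by (meson finite.insertI finite_imageI finite_subset)
    moreover have "Some ` ?T \<subseteq> I" by auto
    ultimately have "card ?T \<le> card I"
      by (metis card_image card_mono inj_Some)
    moreover have "(\<Inter>j\<in>?T. A j) \<inter> {x. b < a \<bullet> x} \<subseteq> (\<Inter>o'\<in>I. B o')"
      by (auto simp: B_def split: option.splits)
    ultimately show ?thesis
      using I unfolding ab by (intro exI[of _ ?T]) auto
  qed
  then obtain T where "\<forall>h\<in>H. T h \<subseteq> J \<and> card (T h) \<le> CARD('n) + 1 \<and> (\<Inter>j\<in>T h. A j) \<inter> {x. snd h < fst h \<bullet> x} = {}"
    by metis
  then have T: "\<And>h. h \<in> H \<Longrightarrow> T h \<subseteq> J" "\<And>h. h \<in> H \<Longrightarrow> card (T h) \<le> CARD('n) + 1"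
    "\<And>h. h \<in> H \<Longrightarrow> (\<Inter>j\<in>T h. A j) \<inter> {x. snd h < fst h \<bullet> x} = {}"
    by auto
  have "card (\<Union>h\<in>H. T h) \<le> (\<Sum>h\<in>H. card (T h))"
    using H(1) by (rule card_UN_le)
  also have "\<dots> \<le> (\<Sum>h\<in>H. CARD('n) + 1)"
    using T by (intro sum_mono) auto
  also have "\<dots> \<le> 2 * CARD('n) * (CARD('n) + 1)"
    using H(2) by (metis mult_le_mono1 of_nat_id sum_constant)
  finally have "card (\<Union>h\<in>H. T h) < card J" using card by simp
  moreover have "(\<Union>h\<in>H. T h) \<subseteq> J" using T by blast
  ultimately obtain q where q: "q \<in> J" "\<And>h. h \<in> H \<Longrightarrow> q \<notin> T h"
    using fin by (metis UN_I less_irrefl subsetI subset_antisym)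
  let ?P = "\<Inter>j\<in>J - {q}. A j"
  have "?P \<subseteq> polyhedron_of H"
    using T q by (fastforce simp: polyhedron_of_def not_less[symmetric])
  moreover have "?P \<in> sets lebesgue"
  proof -
    have "closed ?P" using A by (intro closed_INT ballI compact_imp_closed) auto
    then show ?thesis by (intro sets_completionI_sets) (simp add: borel_closed)
  qed
  ultimately have "measure lebesgue ?P \<le> measure lebesgue (polyhedron_of H)"
    using H(4) by (intro measure_mono_fmeasurable)
  then show ?thesis
    using H(5) q(1) by (intro bexI[of _ q]) auto
qed

lemma abs_det_le:
  fixes N :: "real^'n^'n"
  assumes "\<And>i j. \<bar>N $ i $ j\<bar> \<le> B"
  shows "\<bar>det N\<bar> \<le> fact CARD('n) * B ^ CARD('n)"
proof -
  let ?P = "{p. p permutes (UNIV :: 'n set)}"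
  have "\<bar>det N\<bar> \<le> (\<Sum>p\<in>?P. \<bar>of_int (sign p) * (\<Prod>i\<in>UNIV. N $ i $ p i)\<bar>)"
    unfolding det_def by (rule sum_abs)
  also have "\<dots> \<le> (\<Sum>p\<in>?P. B ^ CARD('n))"
  proof (rule sum_mono)
    fix p
    have "(\<Prod>i\<in>UNIV. \<bar>N $ i $ p i\<bar>) \<le> (\<Prod>i\<in>(UNIV::'n set). B)"
      using assms by (intro prod_mono) auto
    then show "\<bar>of_int (sign p) * (\<Prod>i\<in>UNIV. N $ i $ p i)\<bar> \<le> B ^ CARD('n)"
      by (simp add: abs_mult abs_prod sign_def)
  qed
  also have "\<dots> = fact CARD('n) * B ^ CARD('n)"
    by (simp add: card_permutations)
  finally show ?thesis .
qed

lemma interior_nonempty_of_measure: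
  fixes K :: "'a::euclidean_space set"
  assumes "convex K" "0 < measure lebesgue K"
  shows "interior K \<noteq> {}"
proof
  assume "interior K = {}"
  then have "negligible K"
    using assms(1) negligible_convex_interior by blast
  then show False
    using assms(2) by (simp add: negligible_imp_measure0)
qed

text \<open>A maximal frame of \<open>K\<close> has bounded entries and a determinant bounded away
  from 0, so by Cramer's rule its inverse is bounded as well. Hence the inscribed affine cube
  contains a ball about its centre whose radius depends only on \<open>c\<close> and the
  dimension.\<close>

lemma large_convex_contains_ball:
  assumes "0 < c"
  obtains r where "0 < r" "\<And>K :: (real^'n::{finite,wellorder}) set. compact K \<Longrightarrow> convex K \<Longrightarrow>
    K \<subseteq> cbox (\<chi> i. -1) (\<chi> i. 1) \<Longrightarrow> c \<le> measure lebesgue K \<Longrightarrow> \<exists>g. cball g r \<subseteq> K"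
proof
  let ?d = "CARD('n)"
  \<comment> \<open>\<open>C\<close> bounds every determinant with entries of modulus at most 2. The
    radius is chosen so that \<open>r * (2 * ?d * C) = c / 2 ^ ?d\<close>, which is at most
    \<open>\<bar>det A\<bar>\<close>.\<close>
  define C where "C = (fact ?d * 2 ^ ?d :: real)"
  define r where "r = c / (2 * ?d * C * 2 ^ ?d)"
  have C: "0 < C" by (simp add: C_def)
  show r: "0 < r" using assms C by (simp add: r_def)
  fix K :: "((real, 'n) vec) set"
  assume K: "compact K" "convex K" "K \<subseteq> cbox (\<chi> i. -1) (\<chi> i. 1)" "c \<le> measure lebesgue K"
  then have "interior K \<noteq> {}"
    using assms by (intro interior_nonempty_of_measure) auto
  then obtain x0 and A :: "((real, 'n) vec, 'n) vec" where A: "x0 \<in> K" "\<And>k. x0 + column k A \<in> K" "det A \<noteq> 0"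
    "\<And>x. x \<in> K \<Longrightarrow> \<exists>y. (\<forall>k. \<bar>y $ k\<bar> \<le> 1) \<and> x = x0 + A *v y"
    using maximal_frame K(1) by blast
  have unit: "\<bar>x $ i\<bar> \<le> 1" if "x \<in> K" for x i
    using that K(3) by (force simp: mem_box_cart abs_le_iff)
  have entries: "\<bar>A $ i $ k\<bar> \<le> 2" for i k
    using unit[OF A(1), of i] unit[OF A(2), of k i] by (simp add: column_def)
  have det: "c \<le> 2 ^ ?d * \<bar>det A\<bar>"
    using measure_frame_bounds(2)[OF K(1,2) A(1,2,4)] K(4) by linarith
  \<comment> \<open>The centre of the cube \<open>[0, 1/d]^d\<close>; coordinates may change by
    1/(2d) without leaving the cube.\<close>
  define h where "h = (\<chi> k::'n. 1 / (2 * real ?d))"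
  have "z \<in> K" if "z \<in> cball (x0 + A *v h) r" for z
  proof -
    define w where "w = (1 / r) *\<^sub>R (z - (x0 + A *v h))"
    have "norm w \<le> 1"
      using that r by (simp add: w_def dist_norm norm_minus_commute divide_le_eq)
    then have w: "\<bar>w $ i\<bar> \<le> 2" for i
      using component_le_norm_cart[of w i] by linarith
    define y where "y = (\<chi> k. det (\<chi> i j. if j = k then w $ i else A $ i $ j) / det A)"
    have Ay: "A *v y = w"
      using cramer[OF A(3), of y w] by (simp add: y_def)
    have "\<bar>r * y $ k\<bar> \<le> 1 / (2 * ?d)" for k
    proof -
      have "\<bar>det (\<chi> i j. if j = k then w $ i else A $ i $ j)\<bar> \<le> C"
        unfolding C_def using w entries by (intro abs_det_le) auto
      then have "\<bar>y $ k\<bar> * \<bar>det A\<bar> \<le> C"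
        using A(3) by (simp add: y_def abs_divide)
      moreover have "r * (2 * ?d * C) \<le> \<bar>det A\<bar>"
        using det C by (simp add: r_def field_simps)
      ultimately have "\<bar>y $ k\<bar> * (r * (2 * ?d * C)) \<le> C"
        by (meson abs_ge_zero mult_left_mono order_trans)
      then have "\<bar>y $ k\<bar> * r * (2 * ?d) \<le> 1"
        using C by (simp add: field_simps)
      then show ?thesis
        using r by (simp add: abs_mult field_simps)
    qed
    then have "0 \<le> (h + r *\<^sub>R y) $ k" "(h + r *\<^sub>R y) $ k \<le> 1 / ?d" for k
      by (simp_all add: h_def abs_le_iff field_simps)
        (smt (verit, best) field_sum_of_halves abs_le_iff)+
    then have "x0 + A *v (h + r *\<^sub>R y) \<in> K"
      using K(2) A by (intro convex_frame_cube) auto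
    also have "x0 + A *v (h + r *\<^sub>R y) = z"
    proof -
      have "A *v (r *\<^sub>R y) = r *\<^sub>R (A *v y)"
        by (rule linear_scale[OF matrix_vector_mul_linear])
      then show ?thesis
        using r by (simp add: matrix_vector_right_distrib Ay w_def)
    qed
    finally show ?thesis .
  qed
  then show "\<exists>g. cball g r \<subseteq> K" by blast
qed

text \<open>In the coordinates of a maximal frame of \<open>P\<close>, each
  \<open>P \<inter> A x\<close> becomes a convex subset of \<open>[-1, 1]^d\<close> of volume
  bounded below, so it contains a ball of radius \<open>r\<close> and with it a ball of radius
  \<open>r / 2\<close> about a point of a fixed finite net. The pigeonhole principle on the net
  yields \<open>Y\<close>.\<close>

lemma common_part_of_large_subsets:
  assumes "0 < c"
  shows "\<exists>(\<kappa>::real) (v::real). 0 < \<kappa> \<and> 0 < v \<and> (\<forall>P (A :: 'i \<Rightarrow> (real^'n::{finite,wellorder}) set) X.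
    compact P \<and> convex P \<and> 0 < measure lebesgue P \<and> finite X \<and> X \<noteq> {} \<and>
    (\<forall>x\<in>X. compact (A x) \<and> convex (A x) \<and> c * measure lebesgue P \<le> measure lebesgue (P \<inter> A x)) \<longrightarrow>
    (\<exists>Y\<subseteq>X. \<kappa> * card X \<le> card Y \<and> v * measure lebesgue P \<le> measure lebesgue (P \<inter> (\<Inter>x\<in>Y. A x))))"
proof -
  let ?d = "CARD('n)"
  let ?U = "cbox (\<chi> i. -1) (\<chi> i. 1) :: ((real, 'n) vec) set"
  \<comment> \<open>The change of coordinates divides volumes by \<open>\<bar>det M\<bar>\<close>,
    which is at most \<open>d ^ d\<close> times the volume of \<open>P\<close>.\<close>
  define c1 where "c1 = c / real ?d ^ ?d"
  have "0 < c1" using assms by (simp add: c1_def)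
  then obtain r where r: "0 < r" and ball: "\<And>K :: ((real, 'n) vec) set. compact K \<Longrightarrow> convex K \<Longrightarrow>
    K \<subseteq> ?U \<Longrightarrow> c1 \<le> measure lebesgue K \<Longrightarrow> \<exists>g. cball g r \<subseteq> K"
    using large_convex_contains_ball by blast
  obtain Z where Z: "finite Z" "?U \<subseteq> (\<Union>z\<in>Z. ball z (r / 2))"
  proof (rule compactE_image[of ?U ?U "\<lambda>z. ball z (r / 2)"])
    show "?U \<subseteq> (\<Union>z\<in>?U. ball z (r / 2))" using r by force
  qed auto
  have "0 \<in> ?U" by (simp add: mem_box_cart)
  then have "Z \<noteq> {}" using Z by auto
  \<comment> \<open>Back in the original coordinates the common ball has volume
    \<open>\<bar>det M\<bar>\<close> times that of the small ball, while \<open>P\<close> has volume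
    at most \<open>2 ^ d * \<bar>det M\<bar>\<close>.\<close>
  define v where "v = measure lebesgue (cball (0::(real, 'n) vec) (r / 2)) / 2 ^ ?d"
  show ?thesis
  proof (rule exI[of _ "1 / card Z"], rule exI[of _ v], intro conjI allI impI; (elim conjE)?)
    show "0 < 1 / real (card Z)" using Z \<open>Z \<noteq> {}\<close> by (simp add: card_gt_0_iff)
    show "0 < v" using r by (simp add: v_def content_cball_pos)
    fix P and A :: "'i \<Rightarrow> ((real, 'n) vec) set" and X
    assume P: "compact P" "convex P" "0 < measure lebesgue P" and X: "finite X" "X \<noteq> {}"
      and XA: "\<forall>x\<in>X. compact (A x) \<and> convex (A x) \<and> c * measure lebesgue P \<le> measure lebesgue (P \<inter> A x)"
    then have A: "\<And>x. x \<in> X \<Longrightarrow> compact (A x)" "\<And>x. x \<in> X \<Longrightarrow> convex (A x)"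
      and large: "\<And>x. x \<in> X \<Longrightarrow> c * measure lebesgue P \<le> measure lebesgue (P \<inter> A x)"
      by auto
    obtain x0 and M :: "((real, 'n) vec, 'n) vec" where M: "x0 \<in> P" "\<And>k. x0 + column k M \<in> P" "det M \<noteq> 0"
      "\<And>x. x \<in> P \<Longrightarrow> \<exists>y. (\<forall>k. \<bar>y $ k\<bar> \<le> 1) \<and> x = x0 + M *v y"
      using maximal_frame[OF P(1)] interior_nonempty_of_measure[OF P(2,3)] by blast
    obtain B where B: "M ** B = mat 1" "B ** M = mat 1"
      using M(3) by (metis invertible_def invertible_det_nz)
    have MB: "M *v (B *v x) = x" "B *v (M *v x) = x" for x
      by (simp_all add: matrix_vector_mul_assoc B)
    define K where "K x = (*v) B ` (+) (- x0) ` (P \<inter> A x)" for x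
    have image: "(+) x0 ` (*v) M ` K x = P \<inter> A x" for x
      by (simp add: K_def image_image MB)
    have vol: "measure lebesgue ((+) x0 ` (*v) M ` S) = \<bar>det M\<bar> * measure lebesgue S" if "S \<in> lmeasurable" for S
      using that by (simp add: measure_translation measure_linear_image)
    have "\<exists>z\<in>Z. cball z (r / 2) \<subseteq> K x" if x: "x \<in> X" for x
    proof -
      have "continuous_on S ((*v) B)" for S
        by (intro linear_continuous_on) (simp add: linear_conv_bounded_linear[symmetric])
      then have K: "compact (K x)" "convex (K x)"
        unfolding K_def using P A[OF x]
        by (intro compact_continuous_image convex_linear_image compact_translation convex_translation compact_Int convex_Int; simp)+
      have "K x \<subseteq> ?U"
      proof
        fix u assume "u \<in> K x"
        then obtain p where p: "p \<in> P" "u = B *v (p - x0)" by (auto simp: K_def)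
        then obtain y where "\<forall>k. \<bar>y $ k\<bar> \<le> 1" "p = x0 + M *v y" using M(4) by blast
        then show "u \<in> ?U" using p by (auto simp: MB mem_box_cart abs_le_iff minus_le_iff)
      qed
      moreover have "c1 \<le> measure lebesgue (K x)"
      proof -
        have "c1 * \<bar>det M\<bar> \<le> c * measure lebesgue P"
          using measure_frame_bounds(1)[OF P(1,2) M(1,2,4)] assms
          by (simp add: c1_def divide_le_eq mult_ac mult_left_mono)
        also have "\<dots> \<le> \<bar>det M\<bar> * measure lebesgue (K x)"
          using large[OF x] vol[of "K x"] image[of x] K(1) by (simp add: lmeasurable_compact)
        finally show ?thesis using M(3) by (simp add: mult.commute)
      qed
      ultimately obtain g where g: "cball g r \<subseteq> K x" using ball K by blast
      moreover have "g \<in> cball g r" using r by simp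
      ultimately have "g \<in> ?U" using \<open>K x \<subseteq> ?U\<close> by blast
      then obtain z where "z \<in> Z" "dist z g < r / 2" using Z by auto
      then show ?thesis
        using g by (intro bexI[of _ z] order_trans[OF _ g]) (auto simp: cball_subset_cball_iff dist_commute)
    qed
    then obtain f where f: "\<And>x. x \<in> X \<Longrightarrow> f x \<in> Z \<and> cball (f x) (r / 2) \<subseteq> K x" by metis
    then obtain z where z: "z \<in> Z" "card X \<le> card (f -` {z} \<inter> X) * card Z"
      using pigeonhole_card[of f X Z] X(1) Z(1) \<open>Z \<noteq> {}\<close> by auto
    let ?Y = "f -` {z} \<inter> X"
    have "card X / card Z \<le> card ?Y"
      using z(2) Z(1) \<open>Z \<noteq> {}\<close> by (simp add: divide_le_eq card_gt_0_iff flip: of_nat_mult)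
    moreover have "v * measure lebesgue P \<le> measure lebesgue (P \<inter> (\<Inter>x\<in>?Y. A x))"
    proof -
      have "card ?Y \<noteq> 0" using z(2) X by auto
      then obtain x' where x': "x' \<in> ?Y" by (metis card.empty ex_in_conv)
      have "(+) x0 ` (*v) M ` cball z (r / 2) \<subseteq> P \<inter> A x" if "x \<in> ?Y" for x
        using f[of x] that unfolding image[symmetric] by (intro image_mono) auto
      then have sub: "(+) x0 ` (*v) M ` cball z (r / 2) \<subseteq> P \<inter> (\<Inter>x\<in>?Y. A x)"
        using x' by blast
      have "v * measure lebesgue P \<le> v * (2 ^ ?d * \<bar>det M\<bar>)"
        using measure_frame_bounds(2)[OF P(1,2) M(1,2,4)] \<open>0 < v\<close> by (intro mult_left_mono) auto
      also have "\<dots> = \<bar>det M\<bar> * measure lebesgue (cball z (r / 2))"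
        using r by (simp add: v_def content_cball)
      also have "\<dots> = measure lebesgue ((+) x0 ` (*v) M ` cball z (r / 2))"
        by (simp add: vol)
      also have "\<dots> \<le> measure lebesgue (P \<inter> (\<Inter>x\<in>?Y. A x))"
      proof (rule measure_mono_fmeasurable[OF sub])
        show "(+) x0 ` (*v) M ` cball z (r / 2) \<in> sets lebesgue"
          by (intro fmeasurableD measurable_translation measurable_linear_image) auto
        show "P \<inter> (\<Inter>x\<in>?Y. A x) \<in> lmeasurable"
          using P(1) A by (intro lmeasurable_compact compact_Int_closed closed_INT ballI compact_imp_closed) auto
      qed
      finally show ?thesis .
    qed
    ultimately show "\<exists>Y\<subseteq>X. 1 / card Z * card X \<le> card Y \<and> v * measure lebesgue P \<le> measure lebesgue (P \<inter> (\<Inter>x\<in>Y. A x))"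
      by (intro exI[of _ ?Y]) auto
  qed
qed

section \<open>Selection from complete multipartite systems\<close>

text \<open>Repeating an element gives all polyhedra the same range of facet indices, so that a
  facet index can serve as a colour below \<open>L\<close>.\<close>

lemma indexed_by_lessThan:
  assumes "finite H" "H \<noteq> {}" "card H \<le> L"
  shows "\<exists>h. h ` {..<L::nat} = H"
proof -
  obtain f where f: "bij_betw f {0..<card H} H" using ex_bij_betw_nat_finite[OF assms(1)] by blast
  obtain p where p: "p \<in> H" using assms(2) by blast
  have "(\<lambda>l. if l < card H then f l else p) ` {..<L} = H"
  proof
    show "(\<lambda>l. if l < card H then f l else p) ` {..<L} \<subseteq> H"
      using f p by (auto simp: bij_betw_def)
    have "f ` {0..<card H} \<subseteq> (\<lambda>l. if l < card H then f l else p) ` {..<L}"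
      using assms(3) by force
    then show "H \<subseteq> (\<lambda>l. if l < card H then f l else p) ` {..<L}"
      using f by (simp add: bij_betw_def)
  qed
  then show ?thesis by blast
qed

text \<open>\<open>A i j\<close> is member \<open>j\<close> of class \<open>i\<close>. The Ramsey
  statement fixes \<open>t\<close>; then \<open>c\<close> is chosen small enough for the polyhedra
  of all \<open>m\<close>-element subclasses together to leave part of each transversal intersection
  uncovered.\<close>

lemma colourful_selection:
  assumes "0 < m"
  shows "\<exists>t c. 0 < t \<and> 0 < c \<and> (\<forall>A :: nat \<Rightarrow> nat \<Rightarrow> (real^'n::{finite,wellorder}) set.
    (\<forall>i j. compact (A i j) \<and> convex (A i j)) \<longrightarrow>
    (\<forall>S. length S = CARD('n) + 1 \<longrightarrow> set S \<subseteq> {..<t} \<longrightarrow> 1 / 2 \<le> measure lebesgue (\<Inter>i<CARD('n) + 1. A i (S ! i))) \<longrightarrow>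
    (\<exists>i<CARD('n) + 1. \<exists>J\<subseteq>{..<t}. card J = m \<and> c \<le> measure lebesgue (\<Inter>j\<in>J. A i j)))"
proof -
  let ?d = "CARD('n)"
  define r where "r = ?d + 1"
  define L where "L = 2 * ?d"
  have L: "0 < L" by (simp add: L_def)
  obtain N where "\<forall>Vs. length Vs = r \<longrightarrow> (\<forall>V\<in>set Vs. N \<le> card V) \<longrightarrow>
    (\<forall>g. (\<forall>i<r. \<forall>S\<in>listset Vs. \<forall>J\<subseteq>Vs ! i. g i S J < L) \<longrightarrow>
      (\<exists>Js. subclasses m Js Vs \<and>
        (\<forall>i<r. \<exists>j\<in>Js ! i. \<exists>c. \<forall>S\<in>listset Js. S ! i = j \<longrightarrow> g i S (Js ! i) = (c::nat))))"
    using homogeneous_classes[OF assms L, of r] by (rule exE)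
  note N = this[THEN spec, THEN mp, THEN mp, THEN spec, THEN mp]
  define t where "t = max 1 N"
  \<comment> \<open>There are at most \<open>r * 2 ^ t\<close> polyhedra, each of volume at most
    \<open>(2 * ?d) ^ ?d * c\<close>, so their union has volume at most 1/4, which is less than
    1/2.\<close>
  define c where "c = 1 / (4 * (real r * 2 ^ t) * (2 * ?d) ^ ?d)"
  have "0 < t" "0 < c" by (simp_all add: t_def c_def r_def)
  show ?thesis
  proof (rule exI[of _ t], rule exI[of _ c], intro conjI allI impI)
    show "0 < t" "0 < c" by fact+
    fix A :: "nat \<Rightarrow> nat \<Rightarrow> ((real, 'n) vec) set"
    assume A: "\<forall>i j. compact (A i j) \<and> convex (A i j)"
      and meet: "\<forall>S. length S = ?d + 1 \<longrightarrow> set S \<subseteq> {..<t} \<longrightarrow> 1 / 2 \<le> measure lebesgue (\<Inter>i<?d + 1. A i (S ! i))"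
    show "\<exists>i<?d + 1. \<exists>J\<subseteq>{..<t}. card J = m \<and> c \<le> measure lebesgue (\<Inter>j\<in>J. A i j)"
    proof (rule ccontr)
      assume no: "\<not> ?thesis"
      let ?I = "{..<r} \<times> {J. J \<subseteq> {..<t} \<and> card J = m}"
      define outer where "outer i J h \<longleftrightarrow> (\<Inter>j\<in>J. A i j) \<subseteq> polyhedron_of (h ` {..<L}) \<and> polyhedron_of (h ` {..<L}) \<in> lmeasurable \<and>
          measure lebesgue (polyhedron_of (h ` {..<L})) \<le> (2 * ?d) ^ ?d * c" for i J h
      have outer: "\<exists>h. outer i J h" if iJ: "(i, J) \<in> ?I" for i J
      proof -
        have "J \<noteq> {}" using iJ assms by auto
        then have "compact (\<Inter>j\<in>J. A i j)" "convex (\<Inter>j\<in>J. A i j)"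
          using A by (auto intro!: convex_INT compact_Inter)
        then obtain H where H: "finite H" "H \<noteq> {}" "card H \<le> L" "(\<Inter>j\<in>J. A i j) \<subseteq> polyhedron_of H"
          "polyhedron_of H \<in> lmeasurable"
          "measure lebesgue (polyhedron_of H) \<le> (2 * ?d) ^ ?d * measure lebesgue (\<Inter>j\<in>J. A i j)"
          unfolding L_def using outer_polyhedron by metis
        have "measure lebesgue (\<Inter>j\<in>J. A i j) \<le> c"
          using no iJ by (fastforce simp: r_def)
        then have "measure lebesgue (polyhedron_of H) \<le> (2 * ?d) ^ ?d * c"
          using H(6) by (meson mult_left_mono order_trans of_nat_0_le_iff)
        moreover obtain h where "h ` {..<L} = H" using H by (blast dest: indexed_by_lessThan)
        ultimately show ?thesis using H(4,5) unfolding outer_def by blast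
      qed
      define h where "h i J = (SOME h. outer i J h)" for i J
      have "outer i J (h i J)" if "(i, J) \<in> ?I" for i J
        unfolding h_def by (rule someI_ex[OF outer[OF that]])
      then have h: "\<And>i J. (i, J) \<in> ?I \<Longrightarrow> (\<Inter>j\<in>J. A i j) \<subseteq> polyhedron_of (h i J ` {..<L})"
        "\<And>i J. (i, J) \<in> ?I \<Longrightarrow> polyhedron_of (h i J ` {..<L}) \<in> lmeasurable"
        "\<And>i J. (i, J) \<in> ?I \<Longrightarrow> measure lebesgue (polyhedron_of (h i J ` {..<L})) \<le> (2 * ?d) ^ ?d * c"
        by (simp_all add: outer_def)
      define P where "P p = polyhedron_of (h (fst p) (snd p) ` {..<L})" for p
      have fin: "finite ?I" by (auto intro: finite_subset[of _ "Pow {..<t}"])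
      have "card ?I \<le> card ({..<r} \<times> Pow {..<t})"
        by (intro card_mono) auto
      also have "\<dots> = r * 2 ^ t"
        by (simp add: card_cartesian_product card_Pow)
      finally have "real (card ?I) \<le> real (r * 2 ^ t)"
        by (rule of_nat_mono)
      then have card_I: "real (card ?I) \<le> real r * 2 ^ t"
        by (simp only: of_nat_mult of_nat_power of_nat_numeral)
      have Pm: "P p \<in> lmeasurable" if "p \<in> ?I" for p
        using h(2)[of "fst p" "snd p"] that by (simp add: P_def)
      have "measure lebesgue (\<Union>p\<in>?I. P p) \<le> (\<Sum>p\<in>?I. measure lebesgue (P p))"
        using fin Pm by (intro measure_UNION_le) auto
      also have "\<dots> \<le> (\<Sum>p\<in>?I. (2 * ?d) ^ ?d * c)"
        using h(3) by (intro sum_mono) (auto simp: P_def)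
      also have "\<dots> \<le> (real r * 2 ^ t) * ((2 * ?d) ^ ?d * c)"
        using card_I \<open>0 < c\<close> by (simp add: mult_right_mono)
      also have "\<dots> = 1 / 4"
        by (simp add: c_def r_def)
      finally have small: "measure lebesgue (\<Union>p\<in>?I. P p) \<le> 1 / 4" .
      define witness where "witness S y \<longleftrightarrow> (\<forall>i<r. y \<in> A i (S ! i)) \<and> (\<forall>p\<in>?I. y \<notin> P p)" for S y
      have witness: "\<exists>y. witness S y" if S: "length S = r" "set S \<subseteq> {..<t}" for S
      proof (rule ccontr)
        assume "\<not> ?thesis"
        then have "(\<Inter>i<r. A i (S ! i)) \<subseteq> (\<Union>p\<in>?I. P p)" unfolding witness_def by blast
        moreover have "(\<Inter>i<r. A i (S ! i)) \<in> sets lebesgue"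
          using A by (intro fmeasurableD lmeasurable_compact compact_Inter) (auto simp: r_def)
        moreover have "(\<Union>p\<in>?I. P p) \<in> lmeasurable"
          using fin Pm by (intro fmeasurable.finite_UN) auto
        ultimately have "measure lebesgue (\<Inter>i<r. A i (S ! i)) \<le> measure lebesgue (\<Union>p\<in>?I. P p)"
          by (rule measure_mono_fmeasurable)
        moreover have "1 / 2 \<le> measure lebesgue (\<Inter>i<r. A i (S ! i))"
          using meet S by (simp add: r_def)
        ultimately show False using small by linarith
      qed
      define y where "y S = (SOME y. witness S y)" for S
      have "witness S (y S)" if "length S = r" "set S \<subseteq> {..<t}" for S
        unfolding y_def by (rule someI_ex[OF witness[OF that]])
      then have y: "\<And>S i. length S = r \<Longrightarrow> set S \<subseteq> {..<t} \<Longrightarrow> i < r \<Longrightarrow> y S \<in> A i (S ! i)"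
        "\<And>S p. length S = r \<Longrightarrow> set S \<subseteq> {..<t} \<Longrightarrow> p \<in> ?I \<Longrightarrow> y S \<notin> P p"
        unfolding witness_def by blast+
      define Vs where "Vs = replicate r {..<t}"
      have in_Vs: "S \<in> listset Vs \<longleftrightarrow> length S = r \<and> set S \<subseteq> {..<t}" for S
        by (auto simp: Vs_def in_listset_conv_list_all2 list_all2_conv_all_nth set_conv_nth)
      let ?beyond = "\<lambda>i S J l. snd (h i J l) < fst (h i J l) \<bullet> y S"
      \<comment> \<open>The colour is the index of a facet that \<open>y S\<close> lies beyond. The
        default 0 keeps it below \<open>L\<close> for subsets \<open>J\<close> of other sizes, to
        which the Ramsey statement also refers.\<close>
      define g where "g i S J = (if card J = m then SOME l. l < L \<and> ?beyond i S J l else 0)" for i S J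
      have g: "g i S J < L \<and> ?beyond i S J (g i S J)"
        if "i < r" "S \<in> listset Vs" "J \<subseteq> {..<t}" "card J = m" for i S J
      proof -
        have "y S \<notin> P (i, J)" using y(2)[of S "(i, J)"] that in_Vs by auto
        then have "\<exists>l. l < L \<and> ?beyond i S J l"
          by (auto simp: P_def polyhedron_of_def not_le split: prod.splits)
        then have "(SOME l. l < L \<and> ?beyond i S J l) < L \<and> ?beyond i S J (SOME l. l < L \<and> ?beyond i S J l)"
          by (rule someI_ex)
        then show ?thesis using that(4) by (simp add: g_def)
      qed
      have Vs_nth: "Vs ! i = {..<t}" if "i < r" for i using that by (simp add: Vs_def)
      have "\<forall>i<r. \<forall>S\<in>listset Vs. \<forall>J\<subseteq>Vs ! i. g i S J < L"
        using g L Vs_nth by (metis g_def)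
      moreover have "length Vs = r" "\<forall>V\<in>set Vs. N \<le> card V" by (auto simp: Vs_def t_def)
      ultimately obtain Js where Js: "subclasses m Js Vs" and
        mono: "\<forall>i<r. \<exists>j\<in>Js ! i. \<exists>c. \<forall>S\<in>listset Js. S ! i = j \<longrightarrow> g i S (Js ! i) = c"
        using N[of Vs g] by blast
      have lenJ: "length Js = r" using Js by (auto simp: Vs_def dest: list_all2_lengthD)
      have Js_nth: "Js ! i \<subseteq> {..<t}" "card (Js ! i) = m" if "i < r" for i
        using Js that lenJ Vs_nth by (auto simp: list_all2_conv_all_nth)
      have sub: "listset Js \<subseteq> listset Vs" using Js by (intro listset_mono subclasses_subset)
      \<comment> \<open>The point \<open>y S\<close> lies in \<open>C i (S ! i)\<close> for every
        class, so all transversals of these hulls meet; moreover \<open>C i j\<close> is contained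
        in \<open>A i j\<close>.\<close>
      define C where "C i j = convex hull (y ` {S \<in> listset Js. S ! i = j})" for i j
      have fJ: "finite J \<and> J \<noteq> {}" if "J \<in> set Js" for J
        using subclasses_card[OF Js that] assms by (metis card.empty card.infinite less_irrefl)
      have "\<exists>i<DIM((real, 'n) vec) + 1. (\<Inter>j\<in>Js ! i. C i j) \<noteq> {}"
      proof (rule colourful_Helly)
        show "length Js = DIM((real, 'n) vec) + 1" using lenJ by (simp add: r_def)
        show "finite J \<and> J \<noteq> {}" if "J \<in> set Js" for J using fJ that .
        have "finite (listset Js)" using fJ by (intro finite_listset) blast
        then show "compact (C i j)" "convex (C i j)" for i j
          unfolding C_def by (auto intro!: finite_imp_compact_convex_hull)
        show "(\<Inter>i<DIM((real, 'n) vec) + 1. C i (S ! i)) \<noteq> {}" if "S \<in> listset Js" for S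
        proof -
          have "y S \<in> C i (S ! i)" for i
            unfolding C_def using that by (intro hull_inc) auto
          then show ?thesis by blast
        qed
      qed
      then obtain i p where i: "i < r" and p: "\<And>j. j \<in> Js ! i \<Longrightarrow> p \<in> C i j"
        by (auto simp: r_def)
      have "p \<in> A i j" if "j \<in> Js ! i" for j
      proof -
        have "y ` {S \<in> listset Js. S ! i = j} \<subseteq> A i j"
          using y(1) i sub in_Vs by blast
        then have "C i j \<subseteq> A i j"
          unfolding C_def using A by (intro hull_minimal) auto
        then show ?thesis using p that by blast
      qed
      then have pP: "p \<in> polyhedron_of (h i (Js ! i) ` {..<L})"
        using h(1)[of i "Js ! i"] Js_nth[OF i] i by auto
      obtain j where j: "j \<in> Js ! i" and "\<exists>c. \<forall>S\<in>listset Js. S ! i = j \<longrightarrow> g i S (Js ! i) = c"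
        using mono i by blast
      then obtain l where l: "\<And>S. S \<in> listset Js \<Longrightarrow> S ! i = j \<Longrightarrow> g i S (Js ! i) = l"
        by blast
      \<comment> \<open>All chosen points of the member \<open>j\<close>, hence also their hull and
        \<open>p\<close>, lie strictly beyond facet \<open>l\<close>; but \<open>p\<close>, being in
        every \<open>A i j'\<close> with \<open>j'\<close> in \<open>Js ! i\<close>, lies inside the
        polyhedron of this subclass.\<close>
      define a b where "a = fst (h i (Js ! i) l)" and "b = snd (h i (Js ! i) l)"
      have "g i S (Js ! i) < L \<and> ?beyond i S (Js ! i) (g i S (Js ! i))" if "S \<in> listset Js" for S
        using that sub i Js_nth[OF i] by (intro g) auto
      then have S: "l < L \<and> b < a \<bullet> y S" if "S \<in> listset Js" "S ! i = j" for S
        using l that unfolding a_def b_def by metis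
      then have "C i j \<subseteq> {x. b < a \<bullet> x}"
        unfolding C_def by (intro hull_minimal convex_halfspace_gt) auto
      then have "b < a \<bullet> p" using p[OF j] by blast
      moreover have "C i j \<noteq> {}" using p[OF j] by blast
      then obtain S where "S \<in> listset Js" "S ! i = j" by (auto simp: C_def)
      then have "l < L" using S by blast
      then have "a \<bullet> p \<le> b"
        using pP by (auto simp: polyhedron_of_def a_def b_def case_prod_unfold)
      ultimately show False by simp
    qed
  qed
qed

text \<open>The volume is fixed before \<open>\<epsilon>\<close>, since \<open>m\<close>,
  \<open>t\<close>, \<open>c\<close> and \<open>w\<close> come from the dimension alone; only the
  number of grids depends on \<open>\<epsilon>\<close>. Each grid yields a redundant position
  \<open>k\<close> and a set \<open>D\<close> of other positions. A pigeonhole over grids fixes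
  these and all letters except letter \<open>k\<close>, which then ranges over a positive fraction
  of \<open>V\<close> while the body \<open>P\<close> cut out by \<open>D\<close> stays the
  same.\<close>

lemma fractional_selection:
  shows "\<exists>v::real. 0 < v \<and> (\<forall>\<epsilon>::real. 0 < \<epsilon> \<longrightarrow> (\<exists>\<beta>::real. 0 < \<beta> \<and> (\<forall>V (A :: 'i \<Rightarrow> (real^'n::{finite,wellorder}) set).
    finite V \<longrightarrow> V \<noteq> {} \<longrightarrow> (\<forall>x\<in>V. compact (A x) \<and> convex (A x)) \<longrightarrow>
    \<epsilon> * card V ^ (CARD('n) + 1) \<le> card {y \<in> words V (CARD('n) + 1). 1 / 2 \<le> measure lebesgue (\<Inter>x\<in>set y. A x)} \<longrightarrow>
    (\<exists>Y\<subseteq>V. \<beta> * card V \<le> card Y \<and> v \<le> measure lebesgue (\<Inter>x\<in>Y. A x)))))"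
proof -
  let ?d = "CARD('n)"
  \<comment> \<open>The least size at which a redundant member is guaranteed.\<close>
  define m where "m = 2 * ?d * (?d + 1) + 1"
  define C where "C = real ((2 * ?d) ^ ?d)"
  have "0 < m" "0 < C" by (simp_all add: m_def C_def)
  obtain t c where t: "0 < t" and c: "0 < c" and sel: "\<forall>A :: nat \<Rightarrow> nat \<Rightarrow> ((real, 'n) vec) set.
    (\<forall>i j. compact (A i j) \<and> convex (A i j)) \<longrightarrow>
    (\<forall>S. length S = ?d + 1 \<longrightarrow> set S \<subseteq> {..<t} \<longrightarrow> 1 / 2 \<le> measure lebesgue (\<Inter>i<?d + 1. A i (S ! i))) \<longrightarrow>
    (\<exists>i<?d + 1. \<exists>J\<subseteq>{..<t}. card J = m \<and> c \<le> measure lebesgue (\<Inter>j\<in>J. A i j))"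
    using colourful_selection[OF \<open>0 < m\<close>, where 'n = 'n] by (elim exE conjE)
  have "0 < 1 / C" using \<open>0 < C\<close> by simp
  from common_part_of_large_subsets[OF this, where 'i = 'i and 'n = 'n]
  obtain \<kappa> w :: real where \<kappa>: "0 < \<kappa>" and w: "0 < w" and common:
    "\<forall>P (A :: 'i \<Rightarrow> ((real, 'n) vec) set) X.
      compact P \<and> convex P \<and> 0 < measure lebesgue P \<and> finite X \<and> X \<noteq> {} \<and>
      (\<forall>x\<in>X. compact (A x) \<and> convex (A x) \<and> 1 / C * measure lebesgue P \<le> measure lebesgue (P \<inter> A x)) \<longrightarrow>
      (\<exists>Y\<subseteq>X. \<kappa> * card X \<le> card Y \<and> w * measure lebesgue P \<le> measure lebesgue (P \<inter> (\<Inter>x\<in>Y. A x)))"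
    by (elim exE conjE)
  define N where "N = (?d + 1) * t"
  have N: "0 < N" using t by (simp add: N_def)
  show ?thesis
  proof (rule exI[of _ "w * c"], intro conjI allI impI)
    show "0 < w * c" using w c by simp
    fix \<epsilon> :: real assume \<epsilon>: "0 < \<epsilon>"
    obtain \<delta> :: real where \<delta>: "0 < \<delta>" and grids: "\<And>(V :: 'i set) H. finite V \<Longrightarrow> V \<noteq> {} \<Longrightarrow>
      \<epsilon> * card V ^ (?d + 1) \<le> card {y \<in> words V (?d + 1). H y} \<Longrightarrow>
      \<delta> * card V ^ N \<le> card {xs \<in> words V N. grid t (?d + 1) H xs}"
      using dense_grids[OF \<epsilon>, of "?d + 1" t, where 'a = 'i] unfolding N_def by auto
    define \<delta>' where "\<delta>' = \<delta> / (real N * 2 ^ N)"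
    have \<delta>': "0 < \<delta>'" using \<delta> N by (simp add: \<delta>'_def)
    show "\<exists>\<beta>::real. 0 < \<beta> \<and> (\<forall>V (A :: 'i \<Rightarrow> ((real, 'n) vec) set).
    finite V \<longrightarrow> V \<noteq> {} \<longrightarrow> (\<forall>x\<in>V. compact (A x) \<and> convex (A x)) \<longrightarrow>
    \<epsilon> * card V ^ (?d + 1) \<le> card {y \<in> words V (?d + 1). 1 / 2 \<le> measure lebesgue (\<Inter>x\<in>set y. A x)} \<longrightarrow>
    (\<exists>Y\<subseteq>V. \<beta> * card V \<le> card Y \<and> w * c \<le> measure lebesgue (\<Inter>x\<in>Y. A x)))"
    proof (rule exI[of _ "\<kappa> * \<delta>'"], intro conjI allI impI)
      show "0 < \<kappa> * \<delta>'" using \<kappa> \<delta>' by simp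
      fix V :: "'i set" and A :: "'i \<Rightarrow> ((real, 'n) vec) set"
      assume V: "finite V" "V \<noteq> {}" and A: "\<forall>x\<in>V. compact (A x) \<and> convex (A x)"
        and dense: "\<epsilon> * card V ^ (?d + 1) \<le> card {y \<in> words V (?d + 1). 1 / 2 \<le> measure lebesgue (\<Inter>x\<in>set y. A x)}"
      define H where "H y \<longleftrightarrow> 1 / 2 \<le> measure lebesgue (\<Inter>x\<in>set y. A x)" for y
      let ?W = "{xs \<in> words V N. grid t (?d + 1) H xs}"
      have W: "\<delta> * card V ^ N \<le> card ?W"
        using grids[OF V, of H] dense by (simp add: H_def)
      define good where "good xs p \<longleftrightarrow> (case p of (k, D) \<Rightarrow> k < N \<and> D \<subseteq> {..<N} - {k} \<and> D \<noteq> {} \<and>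
        c \<le> measure lebesgue ((\<Inter>l\<in>D. A (xs ! l)) \<inter> A (xs ! k)) \<and>
        measure lebesgue (\<Inter>l\<in>D. A (xs ! l)) \<le> C * measure lebesgue ((\<Inter>l\<in>D. A (xs ! l)) \<inter> A (xs ! k)))" for xs p
      have ex: "\<exists>p. good xs p" if xs: "xs \<in> ?W" for xs
      proof -
        have len: "length xs = N" and sub: "set xs \<subseteq> V" using xs by auto
        have idx: "i * t + j < N" if "i < ?d + 1" "j < t" for i j
        proof -
          have "i * t + j < Suc i * t" using that by simp
          also have "\<dots> \<le> N" unfolding N_def using that by (intro mult_le_mono1) simp
          finally show ?thesis .
        qed
        \<comment> \<open>The selection result quantifies over all indices; the empty set outside
          the grid is compact and convex.\<close>
        define B where "B i j = (if i < ?d + 1 \<and> j < t then A (xs ! (i * t + j)) else {})" for i j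
        have B: "\<forall>i j. compact (B i j) \<and> convex (B i j)"
        proof (intro allI)
          fix i j
          have "xs ! (i * t + j) \<in> V" if "i < ?d + 1" "j < t"
            using idx[OF that] len sub nth_mem by blast
          then show "compact (B i j) \<and> convex (B i j)" using A by (simp add: B_def)
        qed
        have "1 / 2 \<le> measure lebesgue (\<Inter>i<?d + 1. B i (S ! i))" if S: "length S = ?d + 1" "set S \<subseteq> {..<t}" for S
        proof -
          have St: "S ! i < t" if "i < ?d + 1" for i
            using S that by (metis lessThan_iff nth_mem subsetD)
          have "H (map (\<lambda>i. xs ! (i * t + S ! i)) [0..<?d + 1])"
            by (rule grid_D[of t]) (use xs S St in \<open>auto simp: N_def\<close>)
          then have "1 / 2 \<le> measure lebesgue (\<Inter>i\<in>{0..<?d + 1}. A (xs ! (i * t + S ! i)))"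
            unfolding H_def set_map set_upt image_image by simp
          also have "(\<Inter>i\<in>{0..<?d + 1}. A (xs ! (i * t + S ! i))) = (\<Inter>i<?d + 1. B i (S ! i))"
            using St by (intro INF_cong) (auto simp: B_def)
          finally show ?thesis .
        qed
        then obtain i J where i: "i < ?d + 1" and J: "J \<subseteq> {..<t}" "card J = m" "c \<le> measure lebesgue (\<Inter>j\<in>J. B i j)"
          using sel[THEN spec, THEN mp, OF B] by blast
        have fJ: "finite J" using J(1) finite_subset by blast
        then obtain q where q: "q \<in> J" and red: "measure lebesgue (\<Inter>j\<in>J - {q}. B i j) \<le> C * measure lebesgue (\<Inter>j\<in>J. B i j)"
          using redundant_member[OF fJ, of "B i"] J(2) B unfolding C_def m_def by auto
        define k where "k = i * t + q"
        define D where "D = (\<lambda>j. i * t + j) ` (J - {q})"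
        have "(\<Inter>l\<in>D. A (xs ! l)) = (\<Inter>j\<in>J - {q}. B i j)"
          using i J(1) by (auto simp: D_def B_def)
        moreover have "(\<Inter>l\<in>D. A (xs ! l)) \<inter> A (xs ! k) = (\<Inter>j\<in>J. B i j)"
        proof -
          have "A (xs ! k) = B i q" using i J(1) q by (auto simp: k_def B_def)
          then show ?thesis using q calculation by auto
        qed
        moreover have "k < N" unfolding k_def using idx i q J(1) by blast
        moreover have "D \<subseteq> {..<N} - {k}" using idx i J(1) by (auto simp: D_def k_def)
        moreover have "D \<noteq> {}"
        proof
          assume "D = {}"
          then have "J = {q}" using q by (auto simp: D_def)
          then show False using J(2) by (simp add: m_def)
        qed
        ultimately have "good xs (k, D)" using J(3) red by (simp add: good_def)
        then show ?thesis by blast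
      qed
      define pos where "pos xs = (SOME p. good xs p)" for xs
      have pos: "good xs (pos xs)" if "xs \<in> ?W" for xs
        unfolding pos_def by (rule someI_ex[OF ex[OF that]])
      \<comment> \<open>The key records the positions found and the word without its redundant
        letter. There are at most \<open>N * 2 ^ N\<close> positions and
        \<open>card V ^ (N - 1)\<close> words, so some key is shared by at least
        \<open>\<delta>' * card V\<close> grids.\<close>
      define key where "key xs = (pos xs, take (fst (pos xs)) xs @ drop (Suc (fst (pos xs))) xs)" for xs
      let ?K = "({..<N} \<times> Pow {..<N}) \<times> words V (N - 1)"
      have fK: "finite ?K" using V by (auto intro: finite_lists_length_eq)
      have fW: "finite ?W" by (rule finite_subset[OF _ finite_lists_length_eq[OF V(1), of N]]) auto
      have key: "key xs \<in> ?K" if "xs \<in> ?W" for xs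
        using pos[OF that] that by (auto simp: key_def good_def dest: in_set_takeD in_set_dropD split: prod.splits)
      have "0 < \<delta> * card V ^ N" using \<delta> V by (simp add: card_gt_0_iff)
      then have "?W \<noteq> {}" using W by (metis card.empty not_le of_nat_0)
      then have "?K \<noteq> {}" using key by blast
      then obtain y where y: "y \<in> ?K" and fibre: "card ?W \<le> card (key -` {y} \<inter> ?W) * card ?K"
        using pigeonhole_card[of key ?W ?K] key fW fK by auto
      let ?Z = "key -` {y} \<inter> ?W"
      have card_K: "card ?K = N * 2 ^ N * card V ^ (N - 1)"
        by (simp add: card_cartesian_product card_Pow card_lists_length_eq[OF V(1)])
      have "\<delta> * card V * card V ^ (N - 1) = \<delta> * card V ^ N"
        using N by (cases N) auto
      also have "\<dots> \<le> real (card ?Z * card ?K)"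
        using W fibre by (meson of_nat_mono order_trans)
      also have "\<dots> = (card ?Z * (real N * 2 ^ N)) * card V ^ (N - 1)"
        unfolding card_K by simp
      finally have "\<delta> * card V \<le> card ?Z * (real N * 2 ^ N)"
        using V by (simp add: card_gt_0_iff)
      then have Z: "\<delta>' * card V \<le> card ?Z"
        using N by (simp add: \<delta>'_def divide_le_eq mult.commute)
      obtain k D z where y_eq: "y = ((k, D), z)" by (metis surj_pair)
      \<comment> \<open>Reinserting the deleted letter recovers the word, so words with the same key
        differ only in letter \<open>k\<close>.\<close>
      define full where "full x = take k z @ x # drop k z" for x
      have full: "xs = full (xs ! k)" "good xs (k, D)" "xs ! k \<in> V" "length z = N - 1" if "xs \<in> ?Z" for xs
      proof -
        have xs: "pos xs = (k, D)" "z = take k xs @ drop (Suc k) xs" "length xs = N" "set xs \<subseteq> V" "xs \<in> ?W"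
          using that by (auto simp: key_def y_eq)
        show g: "good xs (k, D)" using pos[OF xs(5)] xs(1) by simp
        then have k: "k < N" by (simp add: good_def)
        show "xs = full (xs ! k)"
          using id_take_nth_drop[of k xs] k xs(2,3) by (simp add: full_def)
        show "xs ! k \<in> V" using k xs(3,4) nth_mem by blast
        show "length z = N - 1" using k xs(2,3) by simp
      qed
      define X where "X = (\<lambda>xs. xs ! k) ` ?Z"
      have "inj_on (\<lambda>xs. xs ! k) ?Z"
        using full(1) by (metis (no_types, lifting) inj_onI)
      then have X: "\<delta>' * card V \<le> card X"
        using Z by (simp add: X_def card_image)
      have fX: "finite X" using fW by (simp add: X_def)
      have "0 < \<delta>' * card V" using \<delta>' V by (simp add: card_gt_0_iff)
      then have "X \<noteq> {}" using X by (metis card.empty not_le of_nat_0)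
      then obtain xs0 where xs0: "xs0 \<in> ?Z" by (auto simp: X_def)
      define P where "P = (\<Inter>l\<in>D. A (xs0 ! l))"
      have kD: "k < N" "D \<subseteq> {..<N} - {k}" "D \<noteq> {}"
        using full(2)[OF xs0] by (auto simp: good_def)
      \<comment> \<open>\<open>D\<close> avoids \<open>k\<close>, so the letters that determine this
        intersection agree throughout the fibre.\<close>
      have P_eq: "(\<Inter>l\<in>D. A (xs ! l)) = P" if xs: "xs \<in> ?Z" for xs
      proof -
        have "xs ! l = xs0 ! l" if "l \<in> D" for l
        proof -
          have "l < N" "l \<noteq> k" using kD that by auto
          then have "full x ! l = (if l < k then z ! l else z ! (l - 1))" for x
            using full(4)[OF xs0] kD(1) unfolding full_def
            by (auto simp: nth_append nth_Cons' min_def)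
          then show ?thesis using full(1)[OF xs] full(1)[OF xs0] by metis
        qed
        then show ?thesis unfolding P_def by (intro INF_cong) auto
      qed
      have X_good: "x \<in> V" "c \<le> measure lebesgue (P \<inter> A x)" "measure lebesgue P \<le> C * measure lebesgue (P \<inter> A x)"
        if "x \<in> X" for x
      proof -
        have "x \<in> (\<lambda>xs. xs ! k) ` ?Z" using that by (simp only: X_def)
        then obtain xs where xs: "x = xs ! k" "xs \<in> ?Z" by (rule imageE)
        show "x \<in> V" "c \<le> measure lebesgue (P \<inter> A x)" "measure lebesgue P \<le> C * measure lebesgue (P \<inter> A x)"
          using full(2,3)[OF xs(2)] P_eq[OF xs(2)] xs(1) by (auto simp: good_def)
      qed
      have AD: "compact (A (xs0 ! l)) \<and> convex (A (xs0 ! l))" if "l \<in> D" for l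
      proof -
        have "length xs0 = N" "set xs0 \<subseteq> V" using xs0 by auto
        moreover have "l < N" using that kD(2) by auto
        ultimately have "xs0 ! l \<in> V" by (metis nth_mem subsetD)
        then show ?thesis using A by blast
      qed
      have P: "compact P" "convex P"
        unfolding P_def using AD kD(3) by (auto intro!: compact_Inter convex_INT)
      have cP: "c \<le> measure lebesgue P"
      proof -
        obtain x where x: "x \<in> X" using \<open>X \<noteq> {}\<close> by blast
        have "compact (P \<inter> A x)" using P(1) A X_good(1)[OF x] by (auto intro: compact_Int)
        then have "measure lebesgue (P \<inter> A x) \<le> measure lebesgue P"
          using P(1) by (intro measure_mono_fmeasurable fmeasurableD lmeasurable_compact) auto
        then show ?thesis using X_good(2)[OF x] by simp
      qed
      have "\<exists>Y\<subseteq>X. \<kappa> * card X \<le> card Y \<and> w * measure lebesgue P \<le> measure lebesgue (P \<inter> (\<Inter>x\<in>Y. A x))"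
      proof (rule common[THEN spec, THEN spec, THEN spec, THEN mp], intro conjI ballI)
        show "0 < measure lebesgue P" using cP c by simp
        show "1 / C * measure lebesgue P \<le> measure lebesgue (P \<inter> A x)" if "x \<in> X" for x
          using X_good(3)[OF that] \<open>0 < C\<close> by (simp add: divide_le_eq mult.commute)
      qed (use P fX \<open>X \<noteq> {}\<close> A X_good(1) in auto)
      then obtain Y where Y: "Y \<subseteq> X" "\<kappa> * card X \<le> card Y" "w * measure lebesgue P \<le> measure lebesgue (P \<inter> (\<Inter>x\<in>Y. A x))"
        by blast
      have "\<kappa> * \<delta>' * card V \<le> \<kappa> * card X"
        using X \<kappa> by (simp add: mult.assoc)
      with Y(2) have card_Y: "\<kappa> * \<delta>' * card V \<le> card Y" by linarith
      have "Y \<noteq> {}"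
        using Y(2) \<kappa> fX \<open>X \<noteq> {}\<close> by (auto simp: card_gt_0_iff mult_le_0_iff)
      then have cY: "compact (\<Inter>x\<in>Y. A x)"
        using A X_good(1) Y(1) by (intro compact_Inter) auto
      have "w * c \<le> w * measure lebesgue P" using cP w by simp
      also have "\<dots> \<le> measure lebesgue (P \<inter> (\<Inter>x\<in>Y. A x))" by (rule Y)
      also have "\<dots> \<le> measure lebesgue (\<Inter>x\<in>Y. A x)"
        using P(1) cY by (intro measure_mono_fmeasurable fmeasurableD lmeasurable_compact compact_Int) auto
      finally have "w * c \<le> measure lebesgue (\<Inter>x\<in>Y. A x)" .
      moreover have "Y \<subseteq> V" using Y(1) X_good(1) by blast
      ultimately show "\<exists>Y\<subseteq>V. \<kappa> * \<delta>' * card V \<le> card Y \<and> w * c \<le> measure lebesgue (\<Inter>x\<in>Y. A x)"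
        using card_Y by blast
    qed
  qed
qed

section \<open>Arbitrary Euclidean spaces\<close>

text \<open>The library states the volume of linear images in terms of determinants only for vectors over a well-ordered
  index type.\<close>

typedef (overloaded) ('a::euclidean_space) coordinate = "{..<DIM('a)}"
  by (rule exI[of _ 0]) simp

instantiation coordinate :: (euclidean_space) "{finite, wellorder}"
begin

definition "i \<le> j \<longleftrightarrow> Rep_coordinate i \<le> Rep_coordinate j" for i j :: "'a coordinate"
definition "i < j \<longleftrightarrow> Rep_coordinate i < Rep_coordinate j" for i j :: "'a coordinate"

instance
proof
  have "(UNIV :: 'a coordinate set) = Abs_coordinate ` {..<DIM('a)}"
    by (rule type_definition.Abs_image[OF type_definition_coordinate, symmetric])
  then show "finite (UNIV :: 'a coordinate set)" by (rule ssubst) simp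
  fix P :: "'a coordinate \<Rightarrow> bool" and i
  assume IH: "\<And>i. (\<And>j. j < i \<Longrightarrow> P j) \<Longrightarrow> P i"
  show "P i"
    by (induction i rule: measure_induct_rule[of Rep_coordinate]) (rule IH, simp add: less_coordinate_def)
qed (auto simp: less_eq_coordinate_def less_coordinate_def Rep_coordinate_inject)

end

lemma CARD_coordinate: "CARD('a::euclidean_space coordinate) = DIM('a)"
  using type_definition.card[OF type_definition_coordinate] by simp

text \<open>Coordinates with respect to the orthonormal basis: preimages of boxes are boxes with the
  same side lengths, which identifies the image of Lebesgue measure.\<close>

lemma measure_preserving_coordinates:
  obtains \<phi> :: "'a::euclidean_space \<Rightarrow> real ^ 'a coordinate"
  where "linear \<phi>" "inj \<phi>" "\<And>S. compact S \<Longrightarrow> compact (\<phi> ` S)"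
    "\<And>S. compact S \<Longrightarrow> measure lebesgue (\<phi> ` S) = measure lebesgue S"
proof -
  obtain f where f: "bij_betw f {0..<DIM('a)} (Basis :: 'a set)"
    using ex_bij_betw_nat_finite[OF finite_Basis] by blast
  define e where "e i = f (Rep_coordinate i)" for i :: "'a coordinate"
  have "bij_betw Rep_coordinate (UNIV :: 'a coordinate set) {0..<DIM('a)}"
    using type_definition.Rep_range[OF type_definition_coordinate] Rep_coordinate_inject
    by (auto simp: bij_betw_def inj_on_def atLeast0LessThan)
  then have e: "bij_betw e UNIV Basis"
    using bij_betw_trans[OF _ f] unfolding e_def o_def by blast
  have eB: "e i \<in> Basis" for i using e by (auto simp: bij_betw_def)
  have ee: "e i \<bullet> e j = (if i = j then 1 else 0)" for i j
    using e eB by (auto simp: inner_Basis bij_betw_def inj_on_def)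
  define \<phi> where "\<phi> x = (\<chi> i. x \<bullet> e i)" for x
  \<comment> \<open>The inverse of \<open>\<phi>\<close>; it yields the corners of the preimage of a
    box.\<close>
  define \<psi> where "\<psi> v = (\<Sum>i\<in>UNIV. (v $ i) *\<^sub>R e i)" for v
  have \<psi>: "\<psi> v \<bullet> e i = v $ i" for v i
  proof -
    have "\<psi> v \<bullet> e i = (\<Sum>j\<in>UNIV. if j = i then v $ j else 0)"
      unfolding \<psi>_def inner_sum_left by (intro sum.cong) (auto simp: ee)
    then show ?thesis by simp
  qed
  have lin: "linear \<phi>"
    by (rule linearI) (auto simp: \<phi>_def vec_eq_iff inner_add_left)
  have cont: "continuous_on S \<phi>" for S
    using lin by (intro linear_continuous_on) (simp add: linear_conv_bounded_linear)
  have "\<psi> (\<phi> x) = x" for x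
  proof (rule euclidean_eqI)
    fix b :: 'a assume "b \<in> Basis"
    then obtain i where "b = e i" using e by (auto simp: bij_betw_def)
    then show "\<psi> (\<phi> x) \<bullet> b = x \<bullet> b" by (simp add: \<psi> \<phi>_def)
  qed
  then have inj: "inj \<phi>" by (metis injI)
  have "lborel = distr lborel borel \<phi>"
  proof (rule lborel_eqI)
    fix l u :: "real ^ 'a coordinate"
    assume le: "\<And>b. b \<in> Basis \<Longrightarrow> l \<bullet> b \<le> u \<bullet> b"
    have axes: "bij_betw (\<lambda>i. axis i 1 :: real ^ 'a coordinate) UNIV Basis"
      by (auto simp: bij_betw_def inj_on_def axis_eq_axis Basis_vec_def)
    have lu: "l $ i \<le> u $ i" for i
      using le[of "axis i 1"] axes by (auto simp: bij_betw_def inner_axis)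
    have "\<phi> -` box l u = box (\<psi> l) (\<psi> u)"
    proof -
      have "x \<in> box (\<psi> l) (\<psi> u) \<longleftrightarrow> (\<forall>i. l $ i < x \<bullet> e i \<and> x \<bullet> e i < u $ i)" for x
        unfolding mem_box bij_betw_imp_surj_on[OF e, symmetric] by (simp add: \<psi>)
      then show ?thesis by (auto simp: mem_box_cart \<phi>_def)
    qed
    moreover have "\<phi> \<in> borel_measurable lborel"
      using cont by (simp add: borel_measurable_continuous_onI)
    ultimately have "emeasure (distr lborel borel \<phi>) (box l u) = emeasure lborel (box (\<psi> l) (\<psi> u))"
      by (simp add: emeasure_distr)
    also have "\<dots> = (\<Prod>b\<in>Basis. (\<psi> u - \<psi> l) \<bullet> b)"
    proof (rule emeasure_lborel_box)
      fix b :: 'a assume "b \<in> Basis"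
      then obtain i where "b = e i" using e by (auto simp: bij_betw_def)
      then show "\<psi> l \<bullet> b \<le> \<psi> u \<bullet> b" by (simp add: \<psi> lu)
    qed
    also have "(\<Prod>b\<in>Basis. (\<psi> u - \<psi> l) \<bullet> b) = (\<Prod>i\<in>UNIV. u $ i - l $ i)"
      by (subst prod.reindex_bij_betw[OF e, symmetric]) (simp add: inner_diff_left \<psi>)
    also have "\<dots> = (\<Prod>b\<in>Basis. (u - l) \<bullet> b)"
      by (subst prod.reindex_bij_betw[OF axes, symmetric]) (simp add: inner_axis)
    finally show "emeasure (distr lborel borel \<phi>) (box l u) = (\<Prod>b\<in>Basis. (u - l) \<bullet> b)" .
  qed simp
  note lborel_\<phi> = this
  have comp: "compact (\<phi> ` S)" if "compact S" for S
    using cont that by (rule compact_continuous_image)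
  have "measure lebesgue (\<phi> ` S) = measure lebesgue S" if S: "compact S" for S
  proof -
    have "emeasure lborel (\<phi> ` S) = emeasure (distr lborel borel \<phi>) (\<phi> ` S)"
      using lborel_\<phi> by simp
    also have "\<dots> = emeasure lborel (\<phi> -` (\<phi> ` S))"
      using cont comp[OF S]
      by (subst emeasure_distr) (auto simp: borel_measurable_continuous_onI borel_closed compact_imp_closed)
    also have "\<phi> -` (\<phi> ` S) = S" using inj by (rule inj_vimage_image_eq)
    finally have "measure lborel (\<phi> ` S) = measure lborel S" by (simp add: measure_def)
    moreover have "S \<in> sets lborel" "\<phi> ` S \<in> sets lborel"
      using S comp[OF S] by (auto simp: borel_closed compact_imp_closed)
    ultimately show ?thesis by (simp add: measure_completion)
  qed
  then show thesis using that lin inj comp by blast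
qed

section \<open>From arbitrary convex sets to compact ones\<close>

text \<open>Bounded convex sets are Lebesgue measurable, and balls exhaust the unbounded
  ones.\<close>

lemma convex_measurable_lebesgue:
  fixes S :: "'a::euclidean_space set"
  assumes "convex S"
  shows "S \<in> sets lebesgue"
proof -
  have "S = (\<Union>n. S \<inter> cball 0 (real n))"
    using real_arch_simple by auto
  moreover have "S \<inter> cball 0 (real n) \<in> sets lebesgue" for n
    using assms by (intro fmeasurableD measurable_convex convex_Int) (auto intro: bounded_subset[OF bounded_cball])
  then have "(\<Union>n. S \<inter> cball 0 (real n)) \<in> sets lebesgue"
    by (intro sets.countable_UN) auto
  ultimately show ?thesis by simp
qed

text \<open>Continuity from below along growing balls; lowering the bound from 1 to 1/2 makes it
  attained at a finite radius, also when the volume is infinite. Allowing every larger radius lets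
  finitely many sets share one.\<close>

lemma volume_in_large_ball:
  fixes S :: "'a::euclidean_space set"
  assumes "convex S" "1 \<le> emeasure lebesgue S"
  shows "\<exists>k. \<forall>R\<ge>real k. 1 / 2 \<le> measure lebesgue (S \<inter> cball 0 R)"
proof -
  have fin: "S \<inter> cball 0 R \<in> lmeasurable" for R
    using assms by (intro measurable_convex convex_Int) (auto intro: bounded_subset[OF bounded_cball])
  have "(SUP k. emeasure lebesgue (S \<inter> cball 0 (real k))) = emeasure lebesgue (\<Union>k. S \<inter> cball 0 (real k))"
    using fin by (intro SUP_emeasure_incseq) (auto simp: incseq_def fmeasurableD intro: order_trans)
  also have "(\<Union>k. S \<inter> cball 0 (real k)) = S"
    using real_arch_simple by auto
  finally have SUP: "(SUP k. emeasure lebesgue (S \<inter> cball 0 (real k))) = emeasure lebesgue S" .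
  have "ennreal (1 / 2) < ennreal 1"
    by (rule ennreal_lessI) simp_all
  also have "\<dots> \<le> emeasure lebesgue S"
    using assms(2) by simp
  finally have "ennreal (1 / 2) < (SUP k. emeasure lebesgue (S \<inter> cball 0 (real k)))"
    by (simp only: SUP)
  then obtain k where k: "ennreal (1 / 2) < emeasure lebesgue (S \<inter> cball 0 (real k))"
    unfolding less_SUP_iff by blast
  have "1 / 2 \<le> measure lebesgue (S \<inter> cball 0 R)" if R: "real k \<le> R" for R
  proof -
    have "ennreal (1 / 2) \<le> ennreal (measure lebesgue (S \<inter> cball 0 (real k)))"
      using k fin by (simp add: emeasure_eq_measure2 less_imp_le)
    then have "1 / 2 \<le> measure lebesgue (S \<inter> cball 0 (real k))"
      using ennreal_le_iff[OF measure_nonneg] by blast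
    also have "\<dots> \<le> measure lebesgue (S \<inter> cball 0 R)"
      using fin R by (intro measure_mono_fmeasurable fmeasurableD) auto
    finally show ?thesis .
  qed
  then show ?thesis by blast
qed

text \<open>Passing to closures of truncated sets creates no volume: the interior of a convex set is that of its closure.\<close>

lemma Inter_closures_volume:
  fixes Y :: "'a::euclidean_space set set"
  assumes "\<And>X. X \<in> Y \<Longrightarrow> convex X" "Y \<noteq> {}"
    and "v \<le> measure lebesgue (\<Inter>X\<in>Y. closure (X \<inter> cball 0 R))"
  shows "ennreal v \<le> emeasure lebesgue (\<Inter>Y)"
proof -
  let ?K = "\<Inter>X\<in>Y. closure (X \<inter> cball 0 R)"
  have conv: "convex (X \<inter> cball 0 R)" if "X \<in> Y" for X
    using assms(1)[OF that] by (intro convex_Int) auto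
  have K: "convex ?K" "bounded ?K"
  proof -
    show "convex ?K" using conv by (intro convex_INT convex_closure) auto
    obtain X where "X \<in> Y" using assms(2) by blast
    moreover have "bounded (closure (X \<inter> cball 0 R))"
      by (intro bounded_closure bounded_subset[OF bounded_cball]) auto
    ultimately show "bounded ?K" by (meson INT_lower bounded_subset)
  qed
  have "interior ?K \<subseteq> X" if "X \<in> Y" for X
  proof -
    have "interior ?K \<subseteq> interior (closure (X \<inter> cball 0 R))"
      using that by (intro interior_mono) auto
    also have "\<dots> = interior (X \<inter> cball 0 R)"
      using conv[OF that] by (rule convex_interior_closure)
    also have "\<dots> \<subseteq> X" using interior_subset by blast
    finally show ?thesis .
  qed
  then have sub: "interior ?K \<subseteq> \<Inter>Y" by blast
  have int: "interior ?K \<in> lmeasurable"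
    using K by (intro measurable_convex convex_interior) (auto intro: bounded_subset interior_subset)
  have "measure lebesgue (interior ?K) = measure lebesgue ?K"
    using K by (intro measure_interior negligible_convex_frontier)
  then have "ennreal v \<le> ennreal (measure lebesgue (interior ?K))"
    using assms(3) by (simp add: ennreal_leI)
  also have "\<dots> = emeasure lebesgue (interior ?K)"
    using int by (simp add: emeasure_eq_measure2)
  also have "\<dots> \<le> emeasure lebesgue (\<Inter>Y)"
    using sub assms(1) by (intro emeasure_mono convex_measurable_lebesgue convex_Inter) auto
  finally show ?thesis .
qed

theorem theorem2:
  shows "\<exists>v::real. v > 0 \<and>
    (\<forall>\<alpha>::real. 0 < \<alpha> \<and> \<alpha> < 1 \<longrightarrow>
      (\<exists>\<beta>::real. \<beta> > 0 \<and>
        (\<forall>F :: ('a::euclidean_space) set set.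
           finite F \<and> card F \<ge> DIM('a) + 1 \<and> (\<forall>A\<in>F. convex A) \<and>
           real (card {S. S \<subseteq> F \<and> card S = DIM('a) + 1 \<and>
                           emeasure lebesgue (\<Inter>S) \<ge> 1})
             \<ge> \<alpha> * real (card F choose (DIM('a) + 1))
           \<longrightarrow> (\<exists>G. G \<subseteq> F \<and> real (card G) \<ge> \<beta> * real (card F) \<and>
                     emeasure lebesgue (\<Inter>G) \<ge> ennreal v))))"
proof -
  let ?r = "DIM('a) + 1"
  obtain \<phi> :: "'a \<Rightarrow> real ^ 'a coordinate" where \<phi>: "linear \<phi>" "inj \<phi>" "\<And>S. compact S \<Longrightarrow> compact (\<phi> ` S)"
    "\<And>S. compact S \<Longrightarrow> measure lebesgue (\<phi> ` S) = measure lebesgue S"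
    using measure_preserving_coordinates by blast
  obtain v :: real where v: "0 < v" and select: "\<forall>\<epsilon>::real. 0 < \<epsilon> \<longrightarrow> (\<exists>\<beta>::real. 0 < \<beta> \<and>
    (\<forall>V (A :: 'a set \<Rightarrow> (real ^ 'a coordinate) set).
    finite V \<longrightarrow> V \<noteq> {} \<longrightarrow> (\<forall>x\<in>V. compact (A x) \<and> convex (A x)) \<longrightarrow>
    \<epsilon> * card V ^ ?r \<le> card {y \<in> words V ?r. 1 / 2 \<le> measure lebesgue (\<Inter>x\<in>set y. A x)} \<longrightarrow>
    (\<exists>Y\<subseteq>V. \<beta> * card V \<le> card Y \<and> v \<le> measure lebesgue (\<Inter>x\<in>Y. A x))))"
    using fractional_selection[where 'i = "'a set" and 'n = "'a coordinate", unfolded CARD_coordinate]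
    by (elim exE conjE)
  show ?thesis
  proof (rule exI[of _ v], intro conjI allI impI v)
    fix \<alpha> :: real assume \<alpha>: "0 < \<alpha> \<and> \<alpha> < 1"
    \<comment> \<open>From \<open>n choose r \<ge> (n / r) ^ r\<close>; counting a single word for
      each subset is enough.\<close>
    define \<epsilon> where "\<epsilon> = \<alpha> / real ?r ^ ?r"
    have "0 < \<epsilon>" using \<alpha> by (simp add: \<epsilon>_def)
    with select obtain \<beta> :: real where \<beta>: "0 < \<beta>" and "\<forall>V (A :: 'a set \<Rightarrow> (real ^ 'a coordinate) set).
      finite V \<longrightarrow> V \<noteq> {} \<longrightarrow> (\<forall>x\<in>V. compact (A x) \<and> convex (A x)) \<longrightarrow>
      \<epsilon> * card V ^ ?r \<le> card {y \<in> words V ?r. 1 / 2 \<le> measure lebesgue (\<Inter>x\<in>set y. A x)} \<longrightarrow>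
      (\<exists>Y\<subseteq>V. \<beta> * card V \<le> card Y \<and> v \<le> measure lebesgue (\<Inter>x\<in>Y. A x))"
      by (elim allE[of _ \<epsilon>] impE exE conjE)
    note choice = this(2)[THEN spec, THEN spec, THEN mp, THEN mp, THEN mp, THEN mp]
    show "\<exists>\<beta>::real. \<beta> > 0 \<and>
        (\<forall>F :: 'a set set.
           finite F \<and> card F \<ge> ?r \<and> (\<forall>A\<in>F. convex A) \<and>
           real (card {S. S \<subseteq> F \<and> card S = ?r \<and> emeasure lebesgue (\<Inter>S) \<ge> 1})
             \<ge> \<alpha> * real (card F choose ?r)
           \<longrightarrow> (\<exists>G. G \<subseteq> F \<and> real (card G) \<ge> \<beta> * real (card F) \<and>
                     emeasure lebesgue (\<Inter>G) \<ge> ennreal v))"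
    proof (rule exI[of _ \<beta>], intro conjI allI impI \<beta>, elim conjE)
      fix F :: "'a set set"
      let ?T = "{S. S \<subseteq> F \<and> card S = ?r \<and> emeasure lebesgue (\<Inter>S) \<ge> 1}"
      assume F: "finite F" "?r \<le> card F" "\<forall>A\<in>F. convex A"
        and dense: "\<alpha> * real (card F choose ?r) \<le> real (card ?T)"
      have fT: "finite ?T" using F(1) by (auto intro: finite_subset[of _ "Pow F"])
      have "\<forall>S\<in>?T. \<exists>k. \<forall>R\<ge>real k. 1 / 2 \<le> measure lebesgue (\<Inter>S \<inter> cball 0 R)"
        using F(3) by (intro ballI volume_in_large_ball convex_Inter) auto
      from bchoice[OF this] obtain k where
        k: "\<forall>S\<in>?T. \<forall>R\<ge>real (k S). 1 / 2 \<le> measure lebesgue (\<Inter>S \<inter> cball 0 R)"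
        by (rule exE)
      \<comment> \<open>One radius that is at least every \<open>k S\<close>.\<close>
      define R where "R = (\<Sum>S\<in>?T. real (k S))"
      have R: "1 / 2 \<le> measure lebesgue (\<Inter>S \<inter> cball 0 R)" if "S \<in> ?T" for S
        using that member_le_sum[of S ?T "\<lambda>S. real (k S)"] fT by (intro k[THEN bspec, THEN spec, THEN mp]) (simp_all add: R_def)
      \<comment> \<open>Distinct members may get the same closure; the selection is made in the
        family indexed by \<open>F\<close>, so members of \<open>F\<close> are still what is
        counted.\<close>
      define K where "K X = closure (X \<inter> cball (0::'a) R)" for X
      have K: "compact (K X)" for X
        unfolding K_def by (auto simp: compact_closure intro: bounded_subset[OF bounded_cball])
      have image: "measure lebesgue (\<Inter>X\<in>Y. \<phi> ` K X) = measure lebesgue (\<Inter>X\<in>Y. K X)" if Y_ne: "Y \<noteq> {}" for Y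
      proof -
        obtain X0 where "X0 \<in> Y" using Y_ne by blast
        then have "(\<Inter>X\<in>Y. \<phi> ` K X) = \<phi> ` (\<Inter>X\<in>Y. K X)"
          using \<phi>(2) by (intro image_INT[symmetric]) auto
        moreover have "compact (\<Inter>X\<in>Y. K X)" using K Y_ne by (intro compact_Inter) auto
        ultimately show ?thesis using \<phi>(4) by simp
      qed
      have "\<exists>Y\<subseteq>F. \<beta> * card F \<le> card Y \<and> v \<le> measure lebesgue (\<Inter>X\<in>Y. \<phi> ` K X)"
      proof (rule choice)
        show "finite F" "F \<noteq> {}" using F by auto
        show "\<forall>X\<in>F. compact (\<phi> ` K X) \<and> convex (\<phi> ` K X)"
          using F(3) K \<phi>(1,3) by (auto simp: K_def intro!: convex_linear_image convex_closure convex_Int)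
        let ?G = "{y \<in> words F ?r. 1 / 2 \<le> measure lebesgue (\<Inter>X\<in>set y. \<phi> ` K X)}"
        have enum: "\<exists>y. set y = S \<and> length y = ?r" if "S \<in> ?T" for S
        proof -
          have "finite S" using that by (auto intro: card_ge_0_finite)
          then obtain y where "set y = S" "distinct y" using finite_distinct_list by blast
          then show ?thesis using that distinct_card[of y] by auto
        qed
        \<comment> \<open>A choice of one enumeration per subset; it is injective because
          \<open>set\<close> recovers \<open>S\<close>.\<close>
        define l where "l S = (SOME y. set y = S \<and> length y = ?r)" for S :: "'a set set"
        have l: "set (l S) = S \<and> length (l S) = ?r" if "S \<in> ?T" for S
          unfolding l_def by (rule someI_ex[OF enum[OF that]])
        have "l ` ?T \<subseteq> ?G"
        proof
          fix y assume "y \<in> l ` ?T"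
          then obtain S where S: "S \<in> ?T" "y = l S" by blast
          have "S \<noteq> {}" using S(1) by auto
          have "compact (\<Inter>X\<in>S. K X)" using K \<open>S \<noteq> {}\<close> by (auto intro: compact_Inter)
          moreover have "\<Inter>S \<inter> cball 0 R \<subseteq> (\<Inter>X\<in>S. K X)"
            using closure_subset by (fastforce simp: K_def)
          moreover have "\<Inter>S \<inter> cball 0 R \<in> sets lebesgue"
            using S(1) F(3) by (intro convex_measurable_lebesgue convex_Int convex_Inter) auto
          ultimately have "measure lebesgue (\<Inter>S \<inter> cball 0 R) \<le> measure lebesgue (\<Inter>X\<in>S. K X)"
            by (intro measure_mono_fmeasurable lmeasurable_compact)
          then show "y \<in> ?G"
            using R[OF S(1)] l[OF S(1)] image[OF \<open>S \<noteq> {}\<close>] S by auto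
        qed
        moreover have "inj_on l ?T" by (rule inj_on_inverseI[of _ set]) (use l in auto)
        moreover have "finite ?G"
          by (rule finite_subset[OF _ finite_lists_length_eq[OF F(1), of ?r]]) auto
        ultimately have "card ?T \<le> card ?G" by (intro card_inj_on_le[of l])
        have "\<epsilon> * card F ^ ?r = \<alpha> * (card F / ?r) ^ ?r"
          by (simp add: \<epsilon>_def power_divide)
        also have "\<dots> \<le> \<alpha> * real (card F choose ?r)"
          using binomial_ge_n_over_k_pow_k[OF F(2), where 'a = real] \<alpha> by (intro mult_left_mono) auto
        also have "\<dots> \<le> card ?G" using dense \<open>card ?T \<le> card ?G\<close> by linarith
        finally show "\<epsilon> * card F ^ ?r \<le> card ?G" .
      qed
      then obtain Y where Y: "Y \<subseteq> F" "\<beta> * card F \<le> card Y" "v \<le> measure lebesgue (\<Inter>X\<in>Y. \<phi> ` K X)"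
        by blast
      \<comment> \<open>A positive lower bound on \<open>card Y\<close> makes \<open>Y\<close>
        nonempty, as needed to pass back from the images of closures to the sets themselves.\<close>
      have "0 < \<beta> * card F" using \<beta> F by (intro mult_pos_pos) auto
      then have "Y \<noteq> {}" using Y(2) by auto
      then have "ennreal v \<le> emeasure lebesgue (\<Inter>Y)"
        using Y F(3) image by (intro Inter_closures_volume[of _ _ R]) (auto simp: K_def)
      then show "\<exists>G. G \<subseteq> F \<and> \<beta> * real (card F) \<le> real (card G) \<and> ennreal v \<le> emeasure lebesgue (\<Inter>G)"
        using Y by blast
    qed
  qed
qed

end
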